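(* Let $X$ be a non-empty set and let $C$ be an $X$-generated right cancellative monoid. Then $\mathrm{PT}(C;X)$, with the multiplication $GH := \overline{\widetilde{G\times H}}$, the unary operation $G^+ := \overline{\widetilde{G^{(+)}}}$ and the single-vertex graph with no edges as identity element, is an $X$-generated left adequate monoid.
   Context: Left adequate monoids: for a monoid $M$, write $a\mathrel{\mathcal R^*}b$ if for all $x,y\in M$: $xa=ya\iff xb=yb$. $M$ is left adequate if every $\mathcal R^*$-class contains an idempotent and the idempotents of $M$ commute with each other; then each $\mathcal R^*$-class contains a unique idempotent, and $a^+$ denotes the idempotent in the class of $a$. Left adequate monoids are regarded as algebras of signature $(2,1,0)$ (multiplication, $+$, identity). A left adequate monoid $M$ is $X$-generated if it comes with a (not necessarily injective) map $X\to M$ whose image generates $M$ as a $(2,1,0)$-algebra. For $\mathrm{PT}(C;X)$, the map sends $x\in X$ to the pretzel of the tree consisting of a single edge labelled $x$ from the start vertex to the end vertex. An $X$-generated right cancellative monoid $C$ comes with a map $X\to C$ whose image generates $C$; $[w]_C$ is the value in $C$ of a word $w\in X^*$. $X$-graphs: an $X$-graph $G$ is a finite directed graph (loops and parallel edges, even with equal labels, are allowed) with edges labelled by elements of $X$, with a start vertex $\alpha(G)$ and an end vertex $\omega(G)$ (possibly equal), such that every vertex is reachable by a directed path from $\alpha(G)$. Morphisms map vertices to vertices and edges to edges, preserving start vertex, end vertex, labels and incidence. $X$-graphs are considered up to isomorphism ("$=$" means isomorphic). An $X$-tree is an $X$-graph whose underlying undirected graph is a tree, with all edges oriented away from the start vertex.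 A retract of $G$ is an idempotent endomorphism of $G$ (or its image); $G$ is retracted if its only retract is the identity. Each $X$-graph $G$ has a retracted image under a retract, unique up to isomorphism, denoted $\overline G$ (the core). Idempath identification (with respect to $C$): an idempath in $G$ is a directed path whose label $w\in X^*$ satisfies $[w]_C=1$. An idempath identification identifies the initial and terminal vertices of an idempath (no edges are deleted). A descendant of $G$ is any $X$-graph obtained from $G$ by finitely many successive idempath identifications. $G$ is idempath identified if every idempath in it is a closed path. $\widetilde G$ denotes the unique idempath identified descendant of $G$. Operations: $G\times H$ is obtained from the disjoint union of $G$ and $H$ by identifying $\omega(G)$ with $\alpha(H)$, with start vertex $\alpha(G)$ and end vertex $\omega(H)$. $G^{(+)}$ is $G$ with end vertex moved to $\alpha(G)$. $\mathrm{FLAd}(X)$ is the set of all isomorphism classes of retracted $X$-trees, and $\mathrm{PT}(C;X):=\{\overline{\widetilde T} : T\in\mathrm{FLAd}(X)\}$ (isomorphism types of $X$-graphs). $\overline{\widetilde T}$ is called the pretzel of $T$. *)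

theory Defs
  imports "HOL-Algebra.Group" "Graph_Theory.Arc_Walk" "Graph_Theory.Digraph_Component"
begin

section \<open>Right cancellative and left adequate monoids\<close>

definition right_cancellative :: "('c, 'm) monoid_scheme \<Rightarrow> bool" where
  "right_cancellative C \<longleftrightarrow>
     (\<forall>a\<in>carrier C. \<forall>b\<in>carrier C. \<forall>c\<in>carrier C. a \<otimes>\<^bsub>C\<^esub> c = b \<otimes>\<^bsub>C\<^esub> c \<longrightarrow> a = b)"

definition generated_monoid :: "'x set \<Rightarrow> ('x \<Rightarrow> 'c) \<Rightarrow> ('c, 'm) monoid_scheme \<Rightarrow> bool" where
  "generated_monoid X \<iota> C \<longleftrightarrow>
     monoid C \<and> \<iota> \<in> X \<rightarrow> carrier C \<and>
     (\<forall>H. submonoid H C \<and> \<iota> ` X \<subseteq> H \<longrightarrow> H = carrier C)"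

definition word_value :: "('x \<Rightarrow> 'c) \<Rightarrow> ('c, 'm) monoid_scheme \<Rightarrow> 'x list \<Rightarrow> 'c" where
  "word_value \<iota> C w = foldr (\<lambda>x c. \<iota> x \<otimes>\<^bsub>C\<^esub> c) w \<one>\<^bsub>C\<^esub>"

text \<open>Algebras of signature \<open>(2,1,0)\<close>: the unary operation extends the monoid record.\<close>

record 'a plus_monoid = "'a monoid" +
  uplus :: "'a \<Rightarrow> 'a"

definition Rstar :: "('a, 'm) monoid_scheme \<Rightarrow> 'a \<Rightarrow> 'a \<Rightarrow> bool" where
  "Rstar M a b \<longleftrightarrow> a \<in> carrier M \<and> b \<in> carrier M \<and>
     (\<forall>x\<in>carrier M. \<forall>y\<in>carrier M.
        x \<otimes>\<^bsub>M\<^esub> a = y \<otimes>\<^bsub>M\<^esub> a \<longleftrightarrow> x \<otimes>\<^bsub>M\<^esub> b = y \<otimes>\<^bsub>M\<^esub> b)"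

definition idempotents :: "('a, 'm) monoid_scheme \<Rightarrow> 'a set" where
  "idempotents M = {e \<in> carrier M. e \<otimes>\<^bsub>M\<^esub> e = e}"

text \<open>
  Left adequacy is a property of the underlying monoid; the last conjunct says that the
  unary operation of the algebra is the one determined by it, i.e. \<open>a\<^sup>+\<close> is the
  (necessarily unique) idempotent in the \<open>Rstar\<close>-class of \<open>a\<close>.
\<close>

definition left_adequate_monoid :: "('a, 'm) plus_monoid_scheme \<Rightarrow> bool" where
  "left_adequate_monoid M \<longleftrightarrow>
     monoid M \<and>
     (\<forall>a\<in>carrier M. \<exists>e\<in>idempotents M. Rstar M a e) \<and>
     (\<forall>e\<in>idempotents M. \<forall>f\<in>idempotents M. e \<otimes>\<^bsub>M\<^esub> f = f \<otimes>\<^bsub>M\<^esub> e) \<and>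
     (\<forall>a\<in>carrier M. uplus M a \<in> idempotents M \<and> Rstar M a (uplus M a))"

definition generated_left_adequate_monoid ::
  "'x set \<Rightarrow> ('x \<Rightarrow> 'a) \<Rightarrow> ('a, 'm) plus_monoid_scheme \<Rightarrow> bool" where
  "generated_left_adequate_monoid X \<iota> M \<longleftrightarrow>
     left_adequate_monoid M \<and> \<iota> \<in> X \<rightarrow> carrier M \<and>
     (\<forall>H. submonoid H M \<and> (\<forall>a\<in>H. uplus M a \<in> H) \<and> \<iota> ` X \<subseteq> H \<longrightarrow> H = carrier M)"

section \<open>Labelled graphs\<close>

text \<open>
  The arcs of a \<open>pre_digraph\<close> are abstract objects with a tail and a head, so loops and
  parallel arcs with equal labels are allowed.
\<close>

record ('v, 'e, 'x) xgraph =
  dgraph :: "('v, 'e) pre_digraph"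
  label :: "'e \<Rightarrow> 'x"
  start_vertex :: 'v
  end_vertex :: 'v

abbreviation xverts :: "('v, 'e, 'x) xgraph \<Rightarrow> 'v set" where
  "xverts G \<equiv> verts (dgraph G)"

abbreviation xarcs :: "('v, 'e, 'x) xgraph \<Rightarrow> 'e set" where
  "xarcs G \<equiv> arcs (dgraph G)"

abbreviation xtail :: "('v, 'e, 'x) xgraph \<Rightarrow> 'e \<Rightarrow> 'v" where
  "xtail G \<equiv> tail (dgraph G)"

abbreviation xhead :: "('v, 'e, 'x) xgraph \<Rightarrow> 'e \<Rightarrow> 'v" where
  "xhead G \<equiv> head (dgraph G)"

definition X_graph :: "'x set \<Rightarrow> ('v, 'e, 'x) xgraph \<Rightarrow> bool" where
  "X_graph X G \<longleftrightarrow>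
     fin_digraph (dgraph G) \<and>
     label G \<in> xarcs G \<rightarrow> X \<and>
     start_vertex G \<in> xverts G \<and> end_vertex G \<in> xverts G \<and>
     (\<forall>v\<in>xverts G. start_vertex G \<rightarrow>\<^sup>*\<^bsub>dgraph G\<^esub> v)"

definition morphism ::
  "('v, 'e, 'x) xgraph \<Rightarrow> ('w, 'f, 'x) xgraph \<Rightarrow> ('v \<Rightarrow> 'w) \<Rightarrow> ('e \<Rightarrow> 'f) \<Rightarrow> bool" where
  "morphism G H \<phi> \<psi> \<longleftrightarrow>
     \<phi> \<in> xverts G \<rightarrow> xverts H \<and> \<psi> \<in> xarcs G \<rightarrow> xarcs H \<and>
     \<phi> (start_vertex G) = start_vertex H \<and> \<phi> (end_vertex G) = end_vertex H \<and>
     (\<forall>e\<in>xarcs G. label H (\<psi> e) = label G e \<and>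
        xtail H (\<psi> e) = \<phi> (xtail G e) \<and> xhead H (\<psi> e) = \<phi> (xhead G e))"

definition isomorphic :: "('v, 'e, 'x) xgraph \<Rightarrow> ('w, 'f, 'x) xgraph \<Rightarrow> bool" where
  "isomorphic G H \<longleftrightarrow> (\<exists>\<phi> \<psi>. morphism G H \<phi> \<psi> \<and>
     bij_betw \<phi> (xverts G) (xverts H) \<and> bij_betw \<psi> (xarcs G) (xarcs H))"

text \<open>
  Isomorphism types are sets of graphs on natural numbers; as the graphs are finite, every
  graph (on whatever types of vertices and arcs) has such a copy.
\<close>

type_synonym 'x xgraph_type = "(nat, nat, 'x) xgraph set"

definition iso_type :: "'x set \<Rightarrow> ('v, 'e, 'x) xgraph \<Rightarrow> 'x xgraph_type" where
  "iso_type X G = {H. X_graph X H \<and> isomorphic H G}"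

subsection \<open>Trees\<close>

text \<open>
  The walks in the following digraph are the undirected walks of the given one: the arc
  \<open>(e, True)\<close> is \<open>e\<close> traversed forwards and \<open>(e, False)\<close> is \<open>e\<close> traversed backwards.
\<close>

definition bidirected :: "('v, 'e) pre_digraph \<Rightarrow> ('v, 'e \<times> bool) pre_digraph" where
  "bidirected D = \<lparr> verts = verts D, arcs = arcs D \<times> UNIV,
     tail = (\<lambda>(e, b). if b then tail D e else head D e),
     head = (\<lambda>(e, b). if b then head D e else tail D e) \<rparr>"

text \<open>
  The constant \<open>tree\<close> of the graph library only excludes directed cycles, hence cannot be used
  here. Requiring distinct underlying arcs excludes going back and forth along one arc, but
  loops and pairs of parallel or antiparallel arcs do count as cycles.
\<close>

definition undirected_tree :: "('v, 'e) pre_digraph \<Rightarrow> bool" where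
  "undirected_tree D \<longleftrightarrow> Digraph_Component.connected D \<and>
     \<not> (\<exists>p. pre_digraph.cycle (bidirected D) p \<and> distinct (map fst p))"

text \<open>
  An arc \<open>e\<close> is oriented away from the start vertex if the path joining the start vertex
  to the tail of \<open>e\<close> does not traverse \<open>e\<close>.
\<close>

definition X_tree :: "'x set \<Rightarrow> ('v, 'e, 'x) xgraph \<Rightarrow> bool" where
  "X_tree X G \<longleftrightarrow> X_graph X G \<and> undirected_tree (dgraph G) \<and>
     (\<forall>e\<in>xarcs G. \<exists>p. pre_digraph.apath (bidirected (dgraph G)) (start_vertex G) p (xtail G e) \<and>
        e \<notin> fst ` set p)"

subsection \<open>Retracts\<close>

text \<open>Maps are only relevant on the vertices and arcs of the graph in question.\<close>

definition retract :: "('v, 'e, 'x) xgraph \<Rightarrow> ('v \<Rightarrow> 'v) \<Rightarrow> ('e \<Rightarrow> 'e) \<Rightarrow> bool" where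
  "retract G \<phi> \<psi> \<longleftrightarrow> morphism G G \<phi> \<psi> \<and>
     (\<forall>v\<in>xverts G. \<phi> (\<phi> v) = \<phi> v) \<and> (\<forall>e\<in>xarcs G. \<psi> (\<psi> e) = \<psi> e)"

definition retracted :: "('v, 'e, 'x) xgraph \<Rightarrow> bool" where
  "retracted G \<longleftrightarrow> (\<forall>\<phi> \<psi>. retract G \<phi> \<psi> \<longrightarrow>
     (\<forall>v\<in>xverts G. \<phi> v = v) \<and> (\<forall>e\<in>xarcs G. \<psi> e = e))"

definition retract_image ::
  "('v \<Rightarrow> 'v) \<Rightarrow> ('e \<Rightarrow> 'e) \<Rightarrow> ('v, 'e, 'x) xgraph \<Rightarrow> ('v, 'e, 'x) xgraph" where
  "retract_image \<phi> \<psi> G =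
     G\<lparr> dgraph := (dgraph G)\<lparr> verts := \<phi> ` xverts G, arcs := \<psi> ` xarcs G \<rparr> \<rparr>"

text \<open>\<open>H\<close> is a core \<open>G\<close> of \<open>G\<close>; cores are unique only up to isomorphism.\<close>

definition core_of :: "('v, 'e, 'x) xgraph \<Rightarrow> ('v, 'e, 'x) xgraph \<Rightarrow> bool" where
  "core_of G H \<longleftrightarrow> (\<exists>\<phi> \<psi>. retract G \<phi> \<psi> \<and> H = retract_image \<phi> \<psi> G) \<and> retracted H"

subsection \<open>Idempath identification\<close>

text \<open>The vertex \<open>v\<close> is replaced by \<open>u\<close>, which yields the quotient by the identification of the two.\<close>

definition identify :: "'v \<Rightarrow> 'v \<Rightarrow> ('v, 'e, 'x) xgraph \<Rightarrow> ('v, 'e, 'x) xgraph" where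
  "identify u v G = (let f = (\<lambda>w. if w = v then u else w) in
     \<lparr> dgraph = \<lparr> verts = f ` xverts G, arcs = xarcs G, tail = f \<circ> xtail G, head = f \<circ> xhead G \<rparr>,
       label = label G, start_vertex = f (start_vertex G), end_vertex = f (end_vertex G) \<rparr>)"

definition idempath ::
  "('x \<Rightarrow> 'c) \<Rightarrow> ('c, 'm) monoid_scheme \<Rightarrow> ('v, 'e, 'x) xgraph \<Rightarrow> 'v \<Rightarrow> 'e list \<Rightarrow> 'v \<Rightarrow> bool" where
  "idempath \<iota> C G u p v \<longleftrightarrow>
     pre_digraph.awalk (dgraph G) u p v \<and> word_value \<iota> C (map (label G) p) = \<one>\<^bsub>C\<^esub>"

inductive descendant ::
  "('x \<Rightarrow> 'c) \<Rightarrow> ('c, 'm) monoid_scheme \<Rightarrow> ('v, 'e, 'x) xgraph \<Rightarrow> ('v, 'e, 'x) xgraph \<Rightarrow> bool"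
  for \<iota> C G where
  refl: "descendant \<iota> C G G"
| step: "descendant \<iota> C G H \<Longrightarrow> idempath \<iota> C H u p v \<Longrightarrow> descendant \<iota> C G (identify u v H)"

definition idempath_identified ::
  "('x \<Rightarrow> 'c) \<Rightarrow> ('c, 'm) monoid_scheme \<Rightarrow> ('v, 'e, 'x) xgraph \<Rightarrow> bool" where
  "idempath_identified \<iota> C G \<longleftrightarrow> (\<forall>u p v. idempath \<iota> C G u p v \<longrightarrow> u = v)"

text \<open>
  The isomorphism type of the core of the idempath identified descendant of \<open>G\<close>. Since the
  latter is determined only up to isomorphism by \<open>G\<close>, all choices are collected; that they
  form a single isomorphism type is not built into the definition.
\<close>

definition pretzel ::
  "'x set \<Rightarrow> ('x \<Rightarrow> 'c) \<Rightarrow> ('c, 'm) monoid_scheme \<Rightarrow> ('v, 'e, 'x) xgraph \<Rightarrow> 'x xgraph_type" where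
  "pretzel X \<iota> C G =
     (\<Union>H\<in>{H. \<exists>D. descendant \<iota> C G D \<and> idempath_identified \<iota> C D \<and> core_of D H}. iso_type X H)"

section \<open>Operations on graphs\<close>

definition graph_times ::
  "('v, 'e, 'x) xgraph \<Rightarrow> ('w, 'f, 'x) xgraph \<Rightarrow> ('v + 'w, 'e + 'f, 'x) xgraph" where
  "graph_times G H = identify (Inl (end_vertex G)) (Inr (start_vertex H))
     \<lparr> dgraph = \<lparr> verts = xverts G <+> xverts H, arcs = xarcs G <+> xarcs H,
         tail = map_sum (xtail G) (xtail H), head = map_sum (xhead G) (xhead H) \<rparr>,
       label = case_sum (label G) (label H),
       start_vertex = Inl (start_vertex G), end_vertex = Inr (end_vertex H) \<rparr>"

definition graph_plus :: "('v, 'e, 'x) xgraph \<Rightarrow> ('v, 'e, 'x) xgraph" where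
  "graph_plus G = G\<lparr> end_vertex := start_vertex G \<rparr>"

definition trivial_graph :: "(nat, nat, 'x) xgraph" where
  "trivial_graph = \<lparr> dgraph = \<lparr> verts = {0}, arcs = {}, tail = (\<lambda>_. 0), head = (\<lambda>_. 0) \<rparr>,
     label = (\<lambda>_. undefined), start_vertex = 0, end_vertex = 0 \<rparr>"

definition edge_tree :: "'x \<Rightarrow> (nat, nat, 'x) xgraph" where
  "edge_tree x = \<lparr> dgraph = \<lparr> verts = {0, 1}, arcs = {0}, tail = (\<lambda>_. 0), head = (\<lambda>_. 1) \<rparr>,
     label = (\<lambda>_. x), start_vertex = 0, end_vertex = 1 \<rparr>"

section \<open>The algebra of pretzels\<close>

definition FLAd :: "'x set \<Rightarrow> 'x xgraph_type set" where
  "FLAd X = {iso_type X T | T :: (nat, nat, 'x) xgraph. X_tree X T \<and> retracted T}"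

text \<open>
  The operations on isomorphism types range over all representatives; their values are
  elements of the carrier only if the operations are well defined.
\<close>

definition PT :: "'x set \<Rightarrow> ('x \<Rightarrow> 'c) \<Rightarrow> ('c, 'm) monoid_scheme \<Rightarrow> 'x xgraph_type plus_monoid" where
  "PT X \<iota> C =
     \<lparr> carrier = (\<Union>\<T>\<in>FLAd X. pretzel X \<iota> C ` \<T>),
       monoid.mult = (\<lambda>\<G> \<H>. \<Union>G\<in>\<G>. \<Union>H\<in>\<H>. pretzel X \<iota> C (graph_times G H)),
       monoid.one = iso_type X trivial_graph,
       uplus = (\<lambda>\<G>. \<Union>G\<in>\<G>. pretzel X \<iota> C (graph_plus G)) \<rparr>"

end

theory Submission
  imports Defs
begin

text \<open>
  A pretzel is determined by the graphs that it maps to. A homomorphism into an idempath identified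
  graph sends an idempath to a closed path, so it factors through every idempath identification;
  and a graph and its core map to each other. Conversely, two retracted idempath identified graphs
  that map to each other are isomorphic. Hence two graphs \<open>G\<close> and \<open>H\<close> have the same pretzel if and
  only if, for every idempath identified graph \<open>K\<close>, the pairs of vertices of \<open>K\<close> that arise as images
  of the start and end vertex under homomorphisms from \<open>G\<close> are the same as those arising from \<open>H\<close>
  (\<open>pretzel_eq_iff\<close>). This argument yields at the same time that the idempath identified descendant and
  the core of a graph are unique as far as the pretzel is concerned.

  Thus a graph \<open>G\<close> is represented by the relations \<open>end_pairs G K\<close> on the vertices of the graphs \<open>K\<close>.
  Gluing \<open>G\<close> to \<open>H\<close> corresponds to the composition of relations, \<open>G\<^sup>+\<close> to the identity on
  the domain of the relation, and the single vertex to the identity. All equations that hold for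
  relations therefore hold for pretzels: multiplication is associative with a unit, \<open>a\<^sup>+\<close> is
  idempotent, \<open>a\<^sup>+ a = a\<close>, and the elements \<open>a\<^sup>+\<close> commute with each other.

  Left adequacy needs two more facts, which fail for relations in general: every idempotent \<open>e\<close>
  satisfies \<open>e = e\<^sup>+\<close>, and \<open>x a = y a\<close> implies \<open>x a\<^sup>+ = y a\<^sup>+\<close>. They rest on an invariant, here called
  coherence: any two walks from \<open>u\<close> to \<open>v\<close> have the same value in the monoid \<open>C\<close>, and of two
  vertices with walks to a common vertex one has a walk to the other. A tree is coherent because at most
  one arc enters each of its vertices. Idempath identifications preserve coherence because \<open>a b = 1\<close>
  implies \<open>b a = 1\<close> in a right cancellative monoid (\<open>coherent_identify\<close>). In a coherent idempath
  identified graph, two walks with the same value and the same end have the same source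
  (\<open>equal_walk_values_imp_equal_sources\<close>).

  If \<open>e\<close> is an idempotent, represented by a tree \<open>T\<close>, the value \<open>c\<close> of the walk of \<open>T\<close> from start to end
  satisfies \<open>c c = c\<close>, so \<open>c = 1\<close>, and this walk is an idempath; identifying its ends yields
  \<open>e = e\<^sup>+\<close> (\<open>idempotent_similar_plus\<close>). If \<open>x a = y a\<close>, where \<open>x\<close>, \<open>y\<close>, \<open>a\<close> come from trees \<open>G\<close>, \<open>G'\<close>, \<open>T\<close>,
  there is a morphism from \<open>G \<times> T\<close> to the identified descendant \<open>D\<close> of \<open>G' \<times> T\<close>. The copies in \<open>D\<close>
  of the walk through \<open>T\<close> end at the same vertex and have the same value, so they start at the same
  vertex: the morphism sends the end of \<open>G\<close> to the image of the end of \<open>G'\<close>, which gives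
  \<open>x a\<^sup>+ = y a\<^sup>+\<close> (\<open>cancel_into_plus\<close>).

  Finally, a tree with an arc leaving its root is an expression in that arc and two smaller trees, so
  the pretzels of single arcs generate (\<open>pretzel_generated\<close>).
\<close>

section \<open>Walks and homomorphisms\<close>

text \<open>
  Homomorphisms that ignore the base points, so that one graph \<open>K\<close> serves as a target for all choices
  of a start and an end vertex in it.
\<close>

definition graph_hom :: "('v, 'e, 'x) xgraph \<Rightarrow> ('w, 'f, 'x) xgraph \<Rightarrow> ('v \<Rightarrow> 'w) \<Rightarrow> ('e \<Rightarrow> 'f) \<Rightarrow> bool" where
  "graph_hom G K f g \<longleftrightarrow> f \<in> xverts G \<rightarrow> xverts K \<and> g \<in> xarcs G \<rightarrow> xarcs K \<and>
     (\<forall>e\<in>xarcs G. label K (g e) = label G e \<and>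
        xtail K (g e) = f (xtail G e) \<and> xhead K (g e) = f (xhead G e))"

abbreviation walk :: "('v, 'e, 'x) xgraph \<Rightarrow> 'v \<Rightarrow> 'e list \<Rightarrow> 'v \<Rightarrow> bool" where
  "walk G \<equiv> pre_digraph.awalk (dgraph G)"

lemma morphism_iff:
  "morphism G H f g \<longleftrightarrow>
     graph_hom G H f g \<and> f (start_vertex G) = start_vertex H \<and> f (end_vertex G) = end_vertex H"
  by (auto simp: morphism_def graph_hom_def)

lemma graph_hom_comp: "graph_hom G H f g \<Longrightarrow> graph_hom H K f' g' \<Longrightarrow> graph_hom G K (f' \<circ> f) (g' \<circ> g)"
  by (auto simp: graph_hom_def Pi_iff)

lemma morphism_comp:
  "morphism G H f g \<Longrightarrow> morphism H K f' g' \<Longrightarrow> morphism G K (f' \<circ> f) (g' \<circ> g)"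
  by (auto simp: morphism_iff graph_hom_comp)

lemma graph_hom_walk:
  assumes "graph_hom G K f g" and "walk G u p v"
  shows "walk K (f u) (map g p) (f v)" and "map (label K) (map g p) = map (label G) p"
proof -
  have "pre_digraph.cas (dgraph K) (f u) (map g p) (f v)"
    if "pre_digraph.cas (dgraph G) u p v" "set p \<subseteq> xarcs G" for u
    using that
  proof (induction p arbitrary: u)
    case (Cons e p)
    then show ?case using assms(1) by (auto simp: pre_digraph.cas.simps graph_hom_def)
  qed (simp add: pre_digraph.cas.simps)
  then show "walk K (f u) (map g p) (f v)"
    using assms by (auto simp: pre_digraph.awalk_def graph_hom_def Pi_iff)
  show "map (label K) (map g p) = map (label G) p"
    using assms by (auto simp: pre_digraph.awalk_def graph_hom_def)
qed

lemma X_graph_iff: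
  "X_graph X G \<longleftrightarrow> wf_digraph (dgraph G) \<and> finite (xverts G) \<and> finite (xarcs G) \<and>
     label G \<in> xarcs G \<rightarrow> X \<and> start_vertex G \<in> xverts G \<and> end_vertex G \<in> xverts G \<and>
     (\<forall>v\<in>xverts G. \<exists>p. walk G (start_vertex G) p v)"
proof (cases "wf_digraph (dgraph G)")
  case True
  then show ?thesis
    by (auto simp: X_graph_def fin_digraph_def fin_digraph_axioms_def wf_digraph.reachable_awalk)
qed (auto simp: X_graph_def fin_digraph_def)

lemma X_graphD:
  assumes "X_graph X G"
  shows "wf_digraph (dgraph G)" "finite (xverts G)" "finite (xarcs G)"
    "e \<in> xarcs G \<Longrightarrow> label G e \<in> X" "start_vertex G \<in> xverts G" "end_vertex G \<in> xverts G"
    "v \<in> xverts G \<Longrightarrow> \<exists>p. walk G (start_vertex G) p v"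
    "e \<in> xarcs G \<Longrightarrow> xtail G e \<in> xverts G" "e \<in> xarcs G \<Longrightarrow> xhead G e \<in> xverts G"
  using assms unfolding X_graph_iff by (auto simp: wf_digraph_def)

lemma X_graph_image:
  assumes G: "X_graph X G" and m: "morphism G H f g"
    and onto: "f ` xverts G = xverts H" "g ` xarcs G = xarcs H"
  shows "X_graph X H"
proof -
  have h: "graph_hom G H f g" using m by (simp add: morphism_iff)
  have "wf_digraph (dgraph H)"
  proof
    fix e assume "e \<in> xarcs H"
    then obtain e' where "e' \<in> xarcs G" "e = g e'" using onto by blast
    then show "xtail H e \<in> xverts H" "xhead H e \<in> xverts H"
      using h X_graphD(8,9)[OF G] by (auto simp: graph_hom_def)
  qed
  moreover have "\<exists>p. walk H (start_vertex H) p v" if "v \<in> xverts H" for v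
  proof -
    obtain v' where v': "v' \<in> xverts G" "v = f v'" using onto \<open>v \<in> xverts H\<close> by blast
    obtain p where "walk G (start_vertex G) p v'" using X_graphD(7)[OF G v'(1)] by blast
    then show ?thesis using graph_hom_walk(1)[OF h] m v'(2) by (fastforce simp: morphism_iff)
  qed
  moreover have "label H \<in> xarcs H \<rightarrow> X"
    using h X_graphD(4)[OF G] unfolding onto(2)[symmetric] by (auto simp: graph_hom_def)
  moreover have "start_vertex H \<in> xverts H" "end_vertex H \<in> xverts H"
    using m X_graphD(5,6)[OF G] by (auto simp: morphism_def Pi_iff)
  moreover have "finite (xverts H)" "finite (xarcs H)"
    using X_graphD(2,3)[OF G] onto by (metis finite_imageI)+
  ultimately show ?thesis unfolding X_graph_iff by blast
qed

lemma idempath_hom: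
  assumes "graph_hom G K f g" "idempath_identified \<iota> C K" "idempath \<iota> C G u p v"
  shows "f u = f v"
  using assms graph_hom_walk[OF assms(1)] unfolding idempath_def idempath_identified_def
  by metis

section \<open>Isomorphisms and copies on the natural numbers\<close>

lemma isomorphic_inverse:
  assumes "isomorphic G H" "X_graph X G"
  obtains f g f' g' where "morphism G H f g" "morphism H G f' g'"
    "bij_betw f (xverts G) (xverts H)" "bij_betw g (xarcs G) (xarcs H)"
    "\<And>v. v \<in> xverts G \<Longrightarrow> f' (f v) = v" "\<And>e. e \<in> xarcs G \<Longrightarrow> g' (g e) = e"
    "\<And>v. v \<in> xverts H \<Longrightarrow> f (f' v) = v" "\<And>e. e \<in> xarcs H \<Longrightarrow> g (g' e) = e"
proof -
  obtain f g where m: "morphism G H f g"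
    and b: "bij_betw f (xverts G) (xverts H)" "bij_betw g (xarcs G) (xarcs H)"
    using assms(1) unfolding isomorphic_def by blast
  define f' where "f' = inv_into (xverts G) f"
  define g' where "g' = inv_into (xarcs G) g"
  note i = bij_betw_inv_into_left[OF b(1), folded f'_def] bij_betw_inv_into_left[OF b(2), folded g'_def]
    bij_betw_inv_into_right[OF b(1), folded f'_def] bij_betw_inv_into_right[OF b(2), folded g'_def]
  have mem: "f' \<in> xverts H \<rightarrow> xverts G" "g' \<in> xarcs H \<rightarrow> xarcs G"
    using bij_betw_inv_into[OF b(1), folded f'_def] bij_betw_inv_into[OF b(2), folded g'_def]
    by (auto simp: bij_betw_def)
  have "label G (g' e) = label H e \<and> xtail G (g' e) = f' (xtail H e) \<and> xhead G (g' e) = f' (xhead H e)"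
    if "e \<in> xarcs H" for e
  proof -
    have e: "g' e \<in> xarcs G" "g (g' e) = e" using mem i(4) that by auto
    then have "label G (g' e) = label H e" "xtail H e = f (xtail G (g' e))"
      "xhead H e = f (xhead G (g' e))"
      using m unfolding morphism_def by metis+
    then show ?thesis using i(1) X_graphD(8,9)[OF assms(2)] e(1) by auto
  qed
  then have "morphism H G f' g'"
    using m mem i(1) X_graphD(5,6)[OF assms(2)] unfolding morphism_def by (metis (no_types, lifting))
  then show ?thesis using that m b i by blast
qed

text \<open>
  Pretzels are sets of graphs on the natural numbers, whereas products are built on sum types; copies
  mediate between the two.
\<close>

lemma isomorphic_nat_copy:
  fixes G :: "('v, 'e, 'x) xgraph"
  assumes "X_graph X G"
  obtains H :: "(nat, nat, 'x) xgraph" where "X_graph X H" "isomorphic H G" "isomorphic G H"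
proof -
  obtain a :: "'v \<Rightarrow> nat" where a: "inj_on a (xverts G)"
    using finite_imp_inj_to_nat_seg[OF X_graphD(2)[OF assms]] by metis
  obtain b :: "'e \<Rightarrow> nat" where b: "inj_on b (xarcs G)"
    using finite_imp_inj_to_nat_seg[OF X_graphD(3)[OF assms]] by metis
  define c where "c = inv_into (xarcs G) b"
  define H :: "(nat, nat, 'x) xgraph" where "H = \<lparr> dgraph = \<lparr> verts = a ` xverts G, arcs = b ` xarcs G,
       tail = (\<lambda>e. a (xtail G (c e))), head = (\<lambda>e. a (xhead G (c e))) \<rparr>,
     label = (\<lambda>e. label G (c e)), start_vertex = a (start_vertex G), end_vertex = a (end_vertex G) \<rparr>"
  have m: "morphism G H a b"
    using b by (auto simp: morphism_def H_def c_def)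
  have bij: "bij_betw a (xverts G) (xverts H)" "bij_betw b (xarcs G) (xarcs H)"
    using a b by (auto simp: H_def bij_betw_def)
  then have iso: "isomorphic G H" using m unfolding isomorphic_def by blast
  have "isomorphic H G"
  proof (rule isomorphic_inverse[OF iso assms])
    fix f g f' g' assume *: "morphism G H f g" "morphism H G f' g'"
    "bij_betw f (xverts G) (xverts H)" "bij_betw g (xarcs G) (xarcs H)"
    "\<And>v. v \<in> xverts G \<Longrightarrow> f' (f v) = v" "\<And>e. e \<in> xarcs G \<Longrightarrow> g' (g e) = e"
    "\<And>v. v \<in> xverts H \<Longrightarrow> f (f' v) = v" "\<And>e. e \<in> xarcs H \<Longrightarrow> g (g' e) = e"
    have "bij_betw f' (xverts H) (xverts G)" "bij_betw g' (xarcs H) (xarcs G)"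
      using * by (auto intro!: bij_betw_byWitness[where f'=f] bij_betw_byWitness[where f'=g]
          simp: morphism_def)
    then show ?thesis using *(2) unfolding isomorphic_def by blast
  qed
  moreover have "X_graph X H"
    using X_graph_image[OF assms m] bij by (auto simp: bij_betw_def)
  ultimately show ?thesis using that iso by blast
qed

lemma isomorphic_idempath_identified:
  assumes "isomorphic G H" "wf_digraph (dgraph G)" "idempath_identified \<iota> C H"
  shows "idempath_identified \<iota> C G"
  unfolding idempath_identified_def
proof (intro allI impI)
  fix u p v assume p: "idempath \<iota> C G u p v"
  obtain f g where f: "morphism G H f g" "inj_on f (xverts G)"
    using assms(1) by (auto simp: isomorphic_def bij_betw_def)
  have "f u = f v" using idempath_hom[OF _ assms(3) p, of f g] f(1) by (simp add: morphism_iff)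
  moreover have "u \<in> xverts G" "v \<in> xverts G"
    using p assms(2) wf_digraph.awalk_hd_in_verts wf_digraph.awalk_last_in_verts
    by (fastforce simp: idempath_def)+
  ultimately show "u = v" using f(2) by (auto dest: inj_onD)
qed

section \<open>Retracts and cores\<close>

text \<open>
  By the pigeonhole principle the powers of \<open>h\<close> are periodic on \<open>S\<close> from some exponent on; a multiple of
  the period beyond that exponent is the exponent of an idempotent power.
\<close>

lemma finite_idempotent_power:
  assumes "finite S" and "h \<in> S \<rightarrow> S"
  obtains n where "n > 0" "\<And>x. x \<in> S \<Longrightarrow> (h ^^ n) ((h ^^ n) x) = (h ^^ n) x"
proof -
  have mem: "(h ^^ i) x \<in> S" if "x \<in> S" for i x
    using that assms(2) by (induction i) auto
  let ?r = "\<lambda>i. restrict (h ^^ i) S"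
  have "range ?r \<subseteq> S \<rightarrow>\<^sub>E S" using mem by auto
  then have "finite (range ?r)" using assms(1) finite_PiE finite_subset by (metis (no_types, lifting))
  then have "\<not> inj ?r" using infinite_UNIV_nat finite_imageD by blast
  then obtain i j where ij: "i < j" "?r i = ?r j" unfolding inj_def by (metis linorder_neqE_nat)
  define d where "d = j - i"
  have d: "d > 0" "j = d + i" using ij(1) by (auto simp: d_def)
  have shift: "(h ^^ (m * d + i)) x = (h ^^ i) x" if "x \<in> S" for m x
  proof (induction m)
    case (Suc m)
    have "(h ^^ (Suc m * d + i)) x = (h ^^ (m * d)) ((h ^^ j) x)"
      unfolding d(2) by (simp add: funpow_add[symmetric] algebra_simps flip: comp_apply[of "_ ^^ _"])
    also have "(h ^^ j) x = (h ^^ i) x" using ij(2) that by (metis restrict_apply')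
    also have "(h ^^ (m * d)) ((h ^^ i) x) = (h ^^ i) x" using Suc by (simp add: funpow_add)
    finally show ?case .
  qed simp
  \<comment> \<open>a multiple of the period that is at least \<open>i\<close>\<close>
  define n where "n = Suc i * d"
  have "i \<le> n" using mult_le_mono2[of 1 d "Suc i"] d(1) by (simp add: n_def)
  then obtain k where k: "n = k + i" by (metis le_add_diff_inverse2)
  show ?thesis
  proof
    show "n > 0" using d(1) by (simp add: n_def)
    fix x assume "x \<in> S"
    have "(h ^^ n) ((h ^^ n) x) = (h ^^ k) ((h ^^ (Suc i * d + i)) x)"
      unfolding k n_def[symmetric] by (simp add: funpow_add[symmetric] algebra_simps flip: comp_apply[of "_ ^^ _"])
    also have "\<dots> = (h ^^ n) x" using shift[OF \<open>x \<in> S\<close>, of "Suc i"] by (simp add: k funpow_add)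
    finally show "(h ^^ n) ((h ^^ n) x) = (h ^^ n) x" .
  qed
qed

lemma morphism_funpow: "morphism G G f g \<Longrightarrow> morphism G G (f ^^ n) (g ^^ n)"
proof (induction n)
  case 0 then show ?case by (simp add: morphism_def)
next
  case (Suc n) then have "morphism G G (f ^^ n) (g ^^ n)" by simp
  from morphism_comp[OF this Suc.prems] show ?case by (simp add: comp_def)
qed

text \<open>
  An idempotent power of an endomorphism is a retract, hence the identity, and a function with
  an injective power is injective.
\<close>

lemma retracted_endomorphism_inj:
  assumes G: "X_graph X G" and r: "retracted G" and m: "morphism G G f g"
  shows "inj_on f (xverts G)" "inj_on g (xarcs G)"
proof -
  \<comment> \<open>treating vertices and arcs by one map gives an exponent that works for both\<close>
  let ?h = "map_sum f g"
  have pow: "?h ^^ n = map_sum (f ^^ n) (g ^^ n)" for n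
    by (induction n) (simp_all add: sum.map_id0 sum.map_comp fun_eq_iff comp_def flip: id_def)
  have "finite (xverts G <+> xarcs G)" "?h \<in> (xverts G <+> xarcs G) \<rightarrow> (xverts G <+> xarcs G)"
    using X_graphD(2,3)[OF G] m by (auto simp: morphism_def)
  then obtain n where n: "n > 0"
    "\<And>x. x \<in> xverts G <+> xarcs G \<Longrightarrow> (?h ^^ n) ((?h ^^ n) x) = (?h ^^ n) x"
    using finite_idempotent_power[of "xverts G <+> xarcs G" ?h] by metis
  have "retract G (f ^^ n) (g ^^ n)"
    unfolding retract_def
  proof (intro conjI ballI)
    show "morphism G G (f ^^ n) (g ^^ n)" using m by (rule morphism_funpow)
    show "(f ^^ n) ((f ^^ n) v) = (f ^^ n) v" if "v \<in> xverts G" for v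
      using n(2)[OF InlI[OF that]] by (simp add: pow)
    show "(g ^^ n) ((g ^^ n) e) = (g ^^ n) e" if "e \<in> xarcs G" for e
      using n(2)[OF InrI[OF that]] by (simp add: pow)
  qed
  then have id: "\<forall>v\<in>xverts G. (f ^^ n) v = v" "\<forall>e\<in>xarcs G. (g ^^ n) e = e"
    using r unfolding retracted_def by blast+
  obtain k where "n = Suc k" using n(1) by (cases n) auto
  then have "f ^^ n = f ^^ k \<circ> f" "g ^^ n = g ^^ k \<circ> g" by (simp_all add: funpow_Suc_right del: funpow.simps)
  then show "inj_on f (xverts G)" "inj_on g (xarcs G)"
    using id by (metis comp_apply inj_onI)+
qed

text \<open>
  Both composites are injective endomorphisms, so the graphs have equally many vertices and
  arcs, and the given injective morphisms are bijective.
\<close>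

lemma retracted_isomorphic:
  assumes G: "X_graph X G" "retracted G" and H: "X_graph X H" "retracted H"
    and fg: "morphism G H f g" and fg': "morphism H G f' g'"
  shows "isomorphic G H"
proof -
  note inj = retracted_endomorphism_inj[OF G morphism_comp[OF fg fg']]
    retracted_endomorphism_inj[OF H morphism_comp[OF fg' fg]]
  have *: "f ` xverts G \<subseteq> xverts H" "g ` xarcs G \<subseteq> xarcs H"
    "f' ` xverts H \<subseteq> xverts G" "g' ` xarcs H \<subseteq> xarcs G"
    using fg fg' by (auto simp: morphism_def)
  have i: "inj_on f (xverts G)" "inj_on g (xarcs G)" "inj_on f' (xverts H)" "inj_on g' (xarcs H)"
    using inj inj_on_imageI2 by blast+
  have "card (xverts G) = card (xverts H)" "card (xarcs G) = card (xarcs H)"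
    using i * X_graphD(2,3)[OF G(1)] X_graphD(2,3)[OF H(1)]
    by (auto intro!: antisym card_inj_on_le)
  then have "f ` xverts G = xverts H" "g ` xarcs G = xarcs H"
    using i(1,2) *(1,2) X_graphD(2,3)[OF H(1)] card_subset_eq card_image by metis+
  then show ?thesis using fg i unfolding isomorphic_def bij_betw_def by blast
qed

lemma retract_image_morphisms:
  assumes "retract G \<phi> \<psi>"
  shows "morphism G (retract_image \<phi> \<psi> G) \<phi> \<psi>"
    and "morphism (retract_image \<phi> \<psi> G) G (\<lambda>v. v) (\<lambda>e. e)"
  using assms by (auto simp: retract_def morphism_def retract_image_def)

lemma retract_comp:
  assumes r: "retract G \<phi> \<psi>" and r': "retract (retract_image \<phi> \<psi> G) \<phi>' \<psi>'"
  shows "retract G (\<phi>' \<circ> \<phi>) (\<psi>' \<circ> \<psi>)"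
  unfolding retract_def
proof (intro conjI ballI)
  let ?H = "retract_image \<phi> \<psi> G"
  have m': "morphism ?H ?H \<phi>' \<psi>'" using r' by (simp add: retract_def)
  then show "morphism G G (\<phi>' \<circ> \<phi>) (\<psi>' \<circ> \<psi>)"
    using morphism_comp[OF morphism_comp[OF retract_image_morphisms(1)[OF r] m']
        retract_image_morphisms(2)[OF r]]
    by (simp add: comp_def)
  show "(\<phi>' \<circ> \<phi>) ((\<phi>' \<circ> \<phi>) v) = (\<phi>' \<circ> \<phi>) v" if "v \<in> xverts G" for v
  proof -
    have "\<phi>' (\<phi> v) \<in> \<phi> ` xverts G" using m' that by (auto simp: morphism_def retract_image_def)
    then have "\<phi> (\<phi>' (\<phi> v)) = \<phi>' (\<phi> v)" using r by (auto simp: retract_def)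
    then show ?thesis using r' that by (auto simp: retract_def retract_image_def)
  qed
  show "(\<psi>' \<circ> \<psi>) ((\<psi>' \<circ> \<psi>) e) = (\<psi>' \<circ> \<psi>) e" if "e \<in> xarcs G" for e
  proof -
    have "\<psi>' (\<psi> e) \<in> \<psi> ` xarcs G" using m' that by (auto simp: morphism_def retract_image_def)
    then have "\<psi> (\<psi>' (\<psi> e)) = \<psi>' (\<psi> e)" using r by (auto simp: retract_def)
    then show ?thesis using r' that by (auto simp: retract_def retract_image_def)
  qed
qed

text \<open>
  A retract with an image of minimal size has a retracted image, as a proper retract of the
  image would compose with it to a smaller one.
\<close>

lemma core_exists:
  fixes G :: "('b, 'c, 'x) xgraph"
  assumes G: "X_graph X G"
  obtains H where "core_of G H"
proof -
  define msr where "msr = (\<lambda>(\<phi> :: 'b \<Rightarrow> 'b, \<psi> :: 'c \<Rightarrow> 'c). card (\<phi> ` xverts G) + card (\<psi> ` xarcs G))"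
  have "case_prod (retract G) (\<lambda>v. v, \<lambda>e. e)" by (simp add: retract_def morphism_def)
  then obtain p where p: "case_prod (retract G) p"
    "\<And>p'. case_prod (retract G) p' \<Longrightarrow> msr p \<le> msr p'"
    by (rule exE[OF ex_has_least_nat[of "case_prod (retract G)" _ msr]]) blast
  obtain \<phi> \<psi> where eq: "p = (\<phi>, \<psi>)" by (cases p)
  note r = p(1)[unfolded eq, simplified]
  have "retracted (retract_image \<phi> \<psi> G)"
    unfolding retracted_def
  proof (intro allI impI)
    fix \<phi>' \<psi>' assume r': "retract (retract_image \<phi> \<psi> G) \<phi>' \<psi>'"
    let ?V = "\<phi> ` xverts G" and ?E = "\<psi> ` xarcs G"
    have sub: "\<phi>' ` ?V \<subseteq> ?V" "\<psi>' ` ?E \<subseteq> ?E"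
      using r' by (auto simp: retract_def morphism_def retract_image_def)
    have fin: "finite ?V" "finite ?E" using X_graphD(2,3)[OF G] by auto
    have "card ?V + card ?E \<le> card (\<phi>' ` ?V) + card (\<psi>' ` ?E)"
      using p(2)[of "(\<phi>' \<circ> \<phi>, \<psi>' \<circ> \<psi>)"] retract_comp[OF r r']
      by (simp add: eq msr_def image_comp)
    moreover have "card (\<phi>' ` ?V) \<le> card ?V" "card (\<psi>' ` ?E) \<le> card ?E"
      using fin by (auto intro: card_image_le)
    ultimately have "card (\<phi>' ` ?V) = card ?V" "card (\<psi>' ` ?E) = card ?E" by linarith+
    then have onto: "\<phi>' ` ?V = ?V" "\<psi>' ` ?E = ?E"
      using card_subset_eq[OF fin(1) sub(1)] card_subset_eq[OF fin(2) sub(2)] by simp_all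
    have idem: "\<forall>v\<in>?V. \<phi>' (\<phi>' v) = \<phi>' v" "\<forall>e\<in>?E. \<psi>' (\<psi>' e) = \<psi>' e"
      using r' by (auto simp: retract_def retract_image_def)
    have "\<phi>' v = v" if "v \<in> ?V" for v
    proof -
      from that onto(1) obtain w where "w \<in> ?V" "v = \<phi>' w" by (metis imageE)
      then show ?thesis using idem by auto
    qed
    moreover have "\<psi>' e = e" if "e \<in> ?E" for e
    proof -
      from that onto(2) obtain w where "w \<in> ?E" "e = \<psi>' w" by (metis imageE)
      then show ?thesis using idem by auto
    qed
    ultimately show "(\<forall>v\<in>xverts (retract_image \<phi> \<psi> G). \<phi>' v = v) \<and>
        (\<forall>e\<in>xarcs (retract_image \<phi> \<psi> G). \<psi>' e = e)"
      by (simp add: retract_image_def)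
  qed
  then show ?thesis using that r unfolding core_of_def by blast
qed

lemma core_ofD:
  assumes "X_graph X G" and "core_of G H"
  obtains f g where "X_graph X H" "retracted H" "morphism G H f g"
    "morphism H G (\<lambda>v. v) (\<lambda>e. e)"
proof -
  obtain \<phi> \<psi> where r: "retract G \<phi> \<psi>" "H = retract_image \<phi> \<psi> G" "retracted H"
    using assms(2) by (auto simp: core_of_def)
  have "X_graph X H"
    unfolding r(2) by (rule X_graph_image[OF assms(1) retract_image_morphisms(1)[OF r(1)]])
      (simp_all add: retract_image_def)
  moreover note retract_image_morphisms[OF r(1), folded r(2)]
  ultimately show ?thesis using that r(3) by metis
qed

lemma core_of_idempath_identified:
  assumes "idempath_identified \<iota> C G" and "core_of G H"
  shows "idempath_identified \<iota> C H"
proof -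
  obtain \<phi> \<psi> where r: "retract G \<phi> \<psi>" "H = retract_image \<phi> \<psi> G"
    using assms(2) by (auto simp: core_of_def)
  show ?thesis
    unfolding idempath_identified_def
  proof (intro allI impI)
    fix u p v assume p: "idempath \<iota> C H u p v"
    show "u = v"
      using idempath_hom[OF _ assms(1) p, of "\<lambda>v. v" "\<lambda>e. e"] retract_image_morphisms(2)[OF r(1)] r(2)
      by (simp add: morphism_iff)
  qed
qed

lemma isomorphic_retracted:
  assumes "isomorphic G H" "X_graph X G" "retracted H"
  shows "retracted G"
proof (rule isomorphic_inverse[OF assms(1,2)])
  fix f g f' g' assume *: "morphism G H f g" "morphism H G f' g'"
    "\<And>v. v \<in> xverts G \<Longrightarrow> f' (f v) = v" "\<And>e. e \<in> xarcs G \<Longrightarrow> g' (g e) = e"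
    "\<And>v. v \<in> xverts H \<Longrightarrow> f (f' v) = v" "\<And>e. e \<in> xarcs H \<Longrightarrow> g (g' e) = e"
  show ?thesis
    unfolding retracted_def
  proof (intro allI impI)
    fix \<phi> \<psi> assume r: "retract G \<phi> \<psi>"
    then have m: "morphism G G \<phi> \<psi>" by (simp add: retract_def)
    have "retract H (f \<circ> (\<phi> \<circ> f')) (g \<circ> (\<psi> \<circ> g'))"
      unfolding retract_def
    proof (intro conjI ballI)
      show "morphism H H (f \<circ> (\<phi> \<circ> f')) (g \<circ> (\<psi> \<circ> g'))"
        by (rule morphism_comp[OF morphism_comp[OF *(2) m] *(1)])
      fix v assume "v \<in> xverts H"
      then have "f' v \<in> xverts G" "\<phi> (f' v) \<in> xverts G" using *(2) m by (auto simp: morphism_def Pi_iff)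
      then show "(f \<circ> (\<phi> \<circ> f')) ((f \<circ> (\<phi> \<circ> f')) v) = (f \<circ> (\<phi> \<circ> f')) v"
        using r *(3) by (simp add: retract_def)
    next
      fix v assume "v \<in> xarcs H"
      then have "g' v \<in> xarcs G" "\<psi> (g' v) \<in> xarcs G" using *(2) m by (auto simp: morphism_def Pi_iff)
      then show "(g \<circ> (\<psi> \<circ> g')) ((g \<circ> (\<psi> \<circ> g')) v) = (g \<circ> (\<psi> \<circ> g')) v"
        using r *(4) by (simp add: retract_def)
    qed
    then have fix': "\<forall>v\<in>xverts H. f (\<phi> (f' v)) = v" "\<forall>e\<in>xarcs H. g (\<psi> (g' e)) = e"
      using assms(3) unfolding retracted_def by (metis comp_apply)+
    show "(\<forall>v\<in>xverts G. \<phi> v = v) \<and> (\<forall>e\<in>xarcs G. \<psi> e = e)"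
    proof (intro conjI ballI)
      fix v assume v: "v \<in> xverts G"
      have "f v \<in> xverts H" "\<phi> v \<in> xverts G" using v *(1) m by (auto simp: morphism_def Pi_iff)
      then have "f (\<phi> v) = f v" using fix'(1) *(3) v by metis
      then show "\<phi> v = v" using *(3) v \<open>\<phi> v \<in> xverts G\<close> by metis
    next
      fix v assume v: "v \<in> xarcs G"
      have "g v \<in> xarcs H" "\<psi> v \<in> xarcs G" using v *(1) m by (auto simp: morphism_def Pi_iff)
      then have "g (\<psi> v) = g v" using fix'(2) *(4) v by metis
      then show "\<psi> v = v" using *(4) v \<open>\<psi> v \<in> xarcs G\<close> by metis
    qed
  qed
qed

section \<open>Idempath identification\<close>

lemma identify_simps:
  "xverts (identify u v G) = (\<lambda>w. if w = v then u else w) ` xverts G"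
  "xarcs (identify u v G) = xarcs G"
  "xtail (identify u v G) e = (if xtail G e = v then u else xtail G e)"
  "xhead (identify u v G) e = (if xhead G e = v then u else xhead G e)"
  "label (identify u v G) = label G"
  "start_vertex (identify u v G) = (if start_vertex G = v then u else start_vertex G)"
  "end_vertex (identify u v G) = (if end_vertex G = v then u else end_vertex G)"
  by (simp_all add: identify_def Let_def)

lemma identify_morphism:
  "morphism G (identify u v G) (\<lambda>w. if w = v then u else w) (\<lambda>e. e)"
  by (auto simp: morphism_def identify_simps)

lemma identify_X_graph: "X_graph X G \<Longrightarrow> X_graph X (identify u v G)"
  by (erule X_graph_image[OF _ identify_morphism]) (simp_all add: identify_simps)

lemma identify_lift:
  assumes "u \<in> xverts G" "graph_hom G K f g" "f u = f v"
  shows "graph_hom (identify u v G) K f g"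
  using assms by (auto simp: graph_hom_def identify_simps Pi_iff)

lemma idempath_in_verts:
  assumes "wf_digraph (dgraph G)" "idempath \<iota> C G u p v"
  shows "u \<in> xverts G" "v \<in> xverts G"
  using assms wf_digraph.awalk_hd_in_verts wf_digraph.awalk_last_in_verts
  by (fastforce simp: idempath_def)+

lemma descendant_X_graph: "descendant \<iota> C G D \<Longrightarrow> X_graph X G \<Longrightarrow> X_graph X D"
  by (induction rule: descendant.induct) (auto intro: identify_X_graph)

text \<open>
  \<open>D\<close> is the reflection of \<open>G\<close> in the idempath identified graphs, with unit \<open>q\<close>. Identification
  keeps the arcs and replaces vertices by other vertices of \<open>G\<close>, so the factor of a homomorphism through
  \<open>q\<close> is given by the same functions.
\<close>

definition reflects :: "('x \<Rightarrow> 'c) \<Rightarrow> ('c, 'm) monoid_scheme \<Rightarrow> ('v, 'e, 'x) xgraph \<Rightarrow>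
    ('v, 'e, 'x) xgraph \<Rightarrow> ('v \<Rightarrow> 'v) \<Rightarrow> bool" where
  "reflects \<iota> C G D q \<longleftrightarrow> morphism G D q (\<lambda>e. e) \<and>
     (\<forall>(K :: (nat, nat, 'x) xgraph) f g. idempath_identified \<iota> C K \<longrightarrow> graph_hom G K f g \<longrightarrow>
        graph_hom D K f g \<and> (\<forall>v\<in>xverts G. f (q v) = f v))"

lemma reflectsD:
  fixes K :: "(nat, nat, 'x) xgraph"
  assumes "reflects \<iota> C G D q"
  shows "morphism G D q (\<lambda>e. e)"
    and "idempath_identified \<iota> C K \<Longrightarrow> graph_hom G K f g \<Longrightarrow> graph_hom D K f g"
    and "idempath_identified \<iota> C K \<Longrightarrow> graph_hom G K f g \<Longrightarrow> v \<in> xverts G \<Longrightarrow> f (q v) = f v"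
  using assms by (simp_all add: reflects_def)

lemma descendant_reflects:
  fixes \<iota> :: "'x \<Rightarrow> 'c" and G :: "('v, 'e, 'x) xgraph"
  assumes "descendant \<iota> C G D" "X_graph X G"
  shows "\<exists>q. reflects \<iota> C G D q"
  using assms
proof (induction rule: descendant.induct)
  case refl
  show ?case by (rule exI[of _ "\<lambda>v. v"]) (auto simp: morphism_def reflects_def)
next
  case (step H u p v)
  from step.IH[OF step.prems] obtain q where q: "reflects \<iota> C G H q" by blast
  let ?c = "\<lambda>w. if w = v then u else w"
  have H: "X_graph X H" using step descendant_X_graph by blast
  have u: "u \<in> xverts H" using idempath_in_verts(1)[OF X_graphD(1)[OF H] step.hyps(2)] .
  have "reflects \<iota> C G (identify u v H) (?c \<circ> q)"
    unfolding reflects_def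
  proof (intro conjI allI impI)
    show "morphism G (identify u v H) (?c \<circ> q) (\<lambda>e. e)"
      using morphism_comp[OF reflectsD(1)[OF q] identify_morphism] by (simp add: comp_def)
    fix f g and K :: "(nat, nat, 'x) xgraph"
    assume K: "idempath_identified \<iota> C K" and f: "graph_hom G K f g"
    note fH = reflectsD(2)[OF q K f]
    have uv: "f u = f v" using idempath_hom[OF fH K step.hyps(2)] .
    show "graph_hom (identify u v H) K f g" by (rule identify_lift[OF u fH uv])
    show "\<forall>w\<in>xverts G. f ((?c \<circ> q) w) = f w" using reflectsD(3)[OF q K f] uv by auto
  qed
  then show ?case by blast
qed

lemma descendant_trans:
  "descendant \<iota> C H D \<Longrightarrow> descendant \<iota> C G H \<Longrightarrow> descendant \<iota> C G D"
  by (induction rule: descendant.induct) (auto intro: descendant.intros)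

text \<open>
  Each identification of two different vertices decreases the number of vertices.
\<close>

lemma identified_descendant_exists:
  assumes "X_graph X G"
  obtains D where "descendant \<iota> C G D" "idempath_identified \<iota> C D"
proof -
  have "\<exists>D. descendant \<iota> C G D \<and> idempath_identified \<iota> C D"
    using assms
  proof (induction "card (xverts G)" arbitrary: G rule: less_induct)
    case less
    show ?case
    proof (cases "idempath_identified \<iota> C G")
      case True
      then show ?thesis using descendant.refl by blast
    next
      case False
      then obtain u p v where p: "idempath \<iota> C G u p v" "u \<noteq> v"
        by (auto simp: idempath_identified_def)
      note uv = idempath_in_verts[OF X_graphD(1)[OF less.prems] p(1)]
      have "xverts (identify u v G) = xverts G - {v}" using uv p(2) by (auto simp: identify_simps)
      then have "card (xverts (identify u v G)) < card (xverts G)"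
        using uv X_graphD(2)[OF less.prems] card_Diff1_less by metis
      then obtain D where "descendant \<iota> C (identify u v G) D" "idempath_identified \<iota> C D"
        using less.hyps identify_X_graph[OF less.prems] by blast
      then show ?thesis using p(1) descendant_trans descendant.intros by metis
    qed
  qed
  then show ?thesis using that by blast
qed

section \<open>Graphs as binary relations\<close>

text \<open>
  The relation on the vertices of \<open>K\<close> that represents \<open>G\<close>.
\<close>

definition end_pairs :: "('v, 'e, 'x) xgraph \<Rightarrow> ('w, 'f, 'x) xgraph \<Rightarrow> ('w \<times> 'w) set" where
  "end_pairs G K = {(f (start_vertex G), f (end_vertex G)) | f g. graph_hom G K f g}"

lemma end_pairsI:
  "graph_hom G K f g \<Longrightarrow> f (start_vertex G) = s \<Longrightarrow> f (end_vertex G) = t \<Longrightarrow> (s, t) \<in> end_pairs G K"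
  unfolding end_pairs_def by blast

lemma end_pairs_antimono:
  assumes "morphism G H f g"
  shows "end_pairs H K \<subseteq> end_pairs G K"
proof
  fix p assume "p \<in> end_pairs H K"
  then obtain f' g' where f': "p = (f' (start_vertex H), f' (end_vertex H))" "graph_hom H K f' g'"
    by (auto simp: end_pairs_def)
  have "graph_hom G K (f' \<circ> f) (g' \<circ> g)"
    using assms f'(2) graph_hom_comp[of G H f g K f' g'] by (simp add: morphism_iff)
  moreover have "p = ((f' \<circ> f) (start_vertex G), (f' \<circ> f) (end_vertex G))"
    using f'(1) assms by (simp add: morphism_iff)
  ultimately show "p \<in> end_pairs G K" unfolding end_pairs_def by blast
qed

lemma end_pairs_plus: "end_pairs (graph_plus G) K = Id_on (Domain (end_pairs G K))"
  by (auto simp: end_pairs_def graph_plus_def graph_hom_def)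

lemma end_pairs_trivial: "end_pairs (trivial_graph :: (nat, nat, 'x) xgraph) K = Id_on (xverts K)"
proof -
  have "graph_hom trivial_graph K (\<lambda>_. v) (\<lambda>_. undefined)" if "v \<in> xverts K" for v
    using that by (simp add: graph_hom_def trivial_graph_def)
  then show ?thesis by (fastforce simp: end_pairs_def graph_hom_def trivial_graph_def)
qed

text \<open>
  The position in the product of the vertices of the second factor.
\<close>

definition glue :: "('v, 'e, 'x) xgraph \<Rightarrow> ('w, 'f, 'x) xgraph \<Rightarrow> 'w \<Rightarrow> 'v + 'w" where
  "glue G H w = (if w = start_vertex H then Inl (end_vertex G) else Inr w)"

lemma graph_times_simps:
  "end_vertex G \<in> xverts G \<Longrightarrow> start_vertex H \<in> xverts H \<Longrightarrow>
     xverts (graph_times G H) = Inl ` xverts G \<union> glue G H ` xverts H"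
  "xarcs (graph_times G H) = xarcs G <+> xarcs H"
  "xtail (graph_times G H) (Inl e) = Inl (xtail G e)"
  "xhead (graph_times G H) (Inl e) = Inl (xhead G e)"
  "label (graph_times G H) (Inl e) = label G e"
  "xtail (graph_times G H) (Inr e') = glue G H (xtail H e')"
  "xhead (graph_times G H) (Inr e') = glue G H (xhead H e')"
  "label (graph_times G H) (Inr e') = label H e'"
  "start_vertex (graph_times G H) = Inl (start_vertex G)"
  "end_vertex (graph_times G H) = glue G H (end_vertex H)"
  by (auto simp: graph_times_def identify_simps glue_def Plus_def image_Un image_image)

lemma graph_times_homs:
  assumes "X_graph X G" "X_graph X H"
  shows "graph_hom G (graph_times G H) Inl Inl" "graph_hom H (graph_times G H) (glue G H) Inr"
  using X_graphD(6)[OF assms(1)] X_graphD(5)[OF assms(2)]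
  by (auto simp: graph_hom_def graph_times_simps)

lemma graph_times_hom_case_sum:
  assumes "X_graph X G" "X_graph X H" and "graph_hom G K f g" "graph_hom H K f' g'"
    and "f (end_vertex G) = f' (start_vertex H)"
  shows "graph_hom (graph_times G H) K (case_sum f f') (case_sum g g')"
proof -
  have "case_sum f f' (glue G H w) = f' w" for w using assms(5) by (simp add: glue_def)
  then show ?thesis
    using X_graphD(6)[OF assms(1)] X_graphD(5)[OF assms(2)] assms(3,4)
    by (auto simp: graph_hom_def graph_times_simps Pi_iff)
qed

text \<open>
  Homomorphisms from the product are pairs of homomorphisms from the factors that agree at the glued
  vertex.
\<close>

lemma end_pairs_times:
  assumes "X_graph X G" "X_graph X H"
  shows "end_pairs (graph_times G H) K = end_pairs G K O end_pairs H K"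
proof (intro equalityI subsetI)
  fix p assume "p \<in> end_pairs (graph_times G H) K"
  then obtain f g where f: "graph_hom (graph_times G H) K f g"
    "p = (f (Inl (start_vertex G)), f (glue G H (end_vertex H)))"
    by (auto simp: end_pairs_def graph_times_simps)
  have "(f (Inl (start_vertex G)), f (Inl (end_vertex G))) \<in> end_pairs G K"
    using graph_hom_comp[OF graph_times_homs(1)[OF assms] f(1)] by (rule end_pairsI) simp_all
  moreover have "(f (Inl (end_vertex G)), f (glue G H (end_vertex H))) \<in> end_pairs H K"
    using graph_hom_comp[OF graph_times_homs(2)[OF assms] f(1)]
    by (rule end_pairsI) (simp_all add: glue_def)
  ultimately show "p \<in> end_pairs G K O end_pairs H K" using f(2) by blast
next
  fix p assume "p \<in> end_pairs G K O end_pairs H K"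
  then obtain f g f' g' where *: "graph_hom G K f g" "graph_hom H K f' g'"
    "f (end_vertex G) = f' (start_vertex H)" "p = (f (start_vertex G), f' (end_vertex H))"
    by (auto simp: end_pairs_def)
  have "p = (case_sum f f' (start_vertex (graph_times G H)), case_sum f f' (end_vertex (graph_times G H)))"
    using *(3,4) by (simp add: graph_times_simps glue_def)
  then show "p \<in> end_pairs (graph_times G H) K"
    using graph_times_hom_case_sum[OF assms *(1-3)] unfolding end_pairs_def by blast
qed

lemma X_graph_plus: "X_graph X G \<Longrightarrow> X_graph X (graph_plus G)"
  by (simp add: X_graph_def graph_plus_def)

lemma X_graph_trivial: "X_graph X trivial_graph"
proof -
  have "wf_digraph (dgraph trivial_graph)" by (simp add: wf_digraph_def trivial_graph_def)
  then show ?thesis unfolding X_graph_iff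
    by (auto simp: trivial_graph_def pre_digraph.awalk_def intro!: exI[of _ "[]"] simp: pre_digraph.cas.simps)
qed

lemma X_graph_edge:
  assumes "x \<in> X" shows "X_graph X (edge_tree x)"
proof -
  have "walk (edge_tree x) 0 [] 0" "walk (edge_tree x) 0 [0] 1"
    by (auto simp: edge_tree_def pre_digraph.awalk_def pre_digraph.cas.simps)
  then show ?thesis using assms unfolding X_graph_iff
    by (auto simp: edge_tree_def wf_digraph_def)
qed

lemma X_graph_times:
  assumes G: "X_graph X G" and H: "X_graph X H"
  shows "X_graph X (graph_times G H)"
proof -
  let ?T = "graph_times G H"
  note simps = graph_times_simps graph_times_simps(1)[OF X_graphD(6)[OF G] X_graphD(5)[OF H]]
  have wf: "wf_digraph (dgraph ?T)"
    by standard (use X_graphD(8,9)[OF G] X_graphD(8,9)[OF H] in \<open>auto simp: simps\<close>)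
  have "\<exists>p. walk ?T (start_vertex ?T) p v" if v: "v \<in> xverts ?T" for v
  proof -
    have 1: "\<exists>p. walk ?T (start_vertex ?T) p (Inl u)" if u: "u \<in> xverts G" for u
    proof -
      obtain p where "walk G (start_vertex G) p u" using X_graphD(7)[OF G u] by blast
      then show ?thesis
        using graph_hom_walk(1)[OF graph_times_homs(1)[OF G H]] by (auto simp: simps)
    qed
    consider u where "u \<in> xverts G" "v = Inl u" | w where "w \<in> xverts H" "v = glue G H w"
      using v unfolding simps(11) by blast
    then show ?thesis
    proof cases
      case 1 then show ?thesis using \<open>\<And>u. u \<in> xverts G \<Longrightarrow> _\<close> by blast
    next
      case 2
      obtain p where "walk H (start_vertex H) p w" using X_graphD(7)[OF H 2(1)] by blast
      then have "walk ?T (glue G H (start_vertex H)) (map Inr p) v"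
        using graph_hom_walk(1)[OF graph_times_homs(2)[OF G H]] 2(2) by blast
      then have "walk ?T (Inl (end_vertex G)) (map Inr p) v" by (simp add: glue_def)
      then show ?thesis using 1[OF X_graphD(6)[OF G]] wf_digraph.awalk_appendI[OF wf] by blast
    qed
  qed
  then show ?thesis
    unfolding X_graph_iff using wf X_graphD[OF G] X_graphD[OF H] by (auto simp: simps)
qed

section \<open>Pretzels\<close>

locale pretzels =
  fixes X :: "'x set" and \<iota> :: "'x \<Rightarrow> 'c" and C :: "('c, 'm) monoid_scheme"
  assumes generated: "generated_monoid X \<iota> C" and cancel: "right_cancellative C"
begin

text \<open>
  Targets on the natural numbers suffice, since every \<open>X\<close>-graph has a copy there. They need not be
  \<open>X\<close>-graphs: an arbitrary pair of vertices of a target may play the role of the base points.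
\<close>

definition similar :: "('v, 'e, 'x) xgraph \<Rightarrow> ('w, 'f, 'x) xgraph \<Rightarrow> bool" (infix \<open>\<simeq>\<close> 50) where
  "G \<simeq> H \<longleftrightarrow> (\<forall>K :: (nat, nat, 'x) xgraph. idempath_identified \<iota> C K \<longrightarrow>
     end_pairs G K = end_pairs H K)"

lemma similar_sym: "G \<simeq> H \<Longrightarrow> H \<simeq> G"
  and similar_trans: "G \<simeq> H \<Longrightarrow> H \<simeq> K \<Longrightarrow> G \<simeq> K"
  by (auto simp: similar_def)

lemma similar_if_morphisms: "morphism G H f g \<Longrightarrow> morphism H G f' g' \<Longrightarrow> G \<simeq> H"
  unfolding similar_def by (blast dest: end_pairs_antimono)

lemma similar_if_isomorphic: "isomorphic G H \<Longrightarrow> X_graph X G \<Longrightarrow> G \<simeq> H"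
  by (erule isomorphic_inverse) (auto intro: similar_if_morphisms)

lemma similar_core: "X_graph X G \<Longrightarrow> core_of G H \<Longrightarrow> G \<simeq> H"
  by (erule core_ofD) (auto intro: similar_if_morphisms)

lemma similar_descendant:
  fixes G :: "('v, 'e, 'x) xgraph"
  assumes "descendant \<iota> C G D" "X_graph X G"
  shows "G \<simeq> D"
  unfolding similar_def
proof (intro allI impI)
  fix K :: "(nat, nat, 'x) xgraph" assume K: "idempath_identified \<iota> C K"
  obtain q where q: "reflects \<iota> C G D q" using descendant_reflects[OF assms] by blast
  note m = reflectsD(1)[OF q, unfolded morphism_iff]
  have "end_pairs G K \<subseteq> end_pairs D K"
  proof
    fix p assume "p \<in> end_pairs G K"
    then obtain f g where f: "p = (f (start_vertex G), f (end_vertex G))" "graph_hom G K f g"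
      by (auto simp: end_pairs_def)
    have "p = (f (start_vertex D), f (end_vertex D))"
      using reflectsD(3)[OF q K f(2)] m f(1) X_graphD(5,6)[OF assms(2)] by metis
    then show "p \<in> end_pairs D K" using reflectsD(2)[OF q K f(2)] unfolding end_pairs_def by blast
  qed
  then show "end_pairs G K = end_pairs D K" using end_pairs_antimono[OF reflectsD(1)[OF q], of K] by blast
qed

text \<open>
  The base points of \<open>H\<close> are related by \<open>end_pairs H H\<close>, hence also by \<open>end_pairs G H\<close>.
\<close>

lemma similar_imp_morphism:
  assumes "G \<simeq> H" "X_graph X H" "idempath_identified \<iota> C H"
  obtains f g where "morphism G H f g"
proof -
  obtain H' :: "(nat, nat, 'x) xgraph" where H': "X_graph X H'" "isomorphic H' H" "isomorphic H H'"
    using isomorphic_nat_copy[OF assms(2)] .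
  obtain f g f' g' where m: "morphism H H' f g" "morphism H' H f' g'"
    by (rule isomorphic_inverse[OF H'(3) assms(2)])
  have "idempath_identified \<iota> C H'"
    using isomorphic_idempath_identified[OF H'(2) X_graphD(1)[OF H'(1)] assms(3)] .
  moreover have "(start_vertex H', end_vertex H') \<in> end_pairs H H'"
    using m(1) unfolding morphism_iff by (blast intro: end_pairsI)
  ultimately have "(start_vertex H', end_vertex H') \<in> end_pairs G H'"
    using assms(1) unfolding similar_def by blast
  then obtain f2 g2 where "morphism G H' f2 g2" unfolding end_pairs_def morphism_iff by auto
  then show ?thesis using that morphism_comp[OF _ m(2)] by blast
qed

text \<open>
  The pretzel of \<open>G\<close> depends only on the similarity class of \<open>G\<close>: identification and taking cores stay in
  this class, and two retracted identified graphs in it are isomorphic because they map to each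
  other. No particular sequence of identifications is referred to, which makes their choice
  irrelevant.
\<close>

lemma in_pretzel_iff:
  assumes G: "X_graph X G"
  shows "H \<in> pretzel X \<iota> C G \<longleftrightarrow>
    X_graph X H \<and> idempath_identified \<iota> C H \<and> retracted H \<and> H \<simeq> G"
proof
  assume "H \<in> pretzel X \<iota> C G"
  then obtain D K where D: "descendant \<iota> C G D" "idempath_identified \<iota> C D" "core_of D K"
    and H: "X_graph X H" "isomorphic H K"
    by (auto simp: pretzel_def iso_type_def)
  have DX: "X_graph X D" using descendant_X_graph[OF D(1) G] .
  obtain f g where K: "retracted K" by (rule core_ofD[OF DX D(3)])
  have "H \<simeq> K" "D \<simeq> K" "G \<simeq> D"
    using similar_if_isomorphic[OF H(2,1)] similar_core[OF DX D(3)] similar_descendant[OF D(1) G] .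
  then have "H \<simeq> G" using similar_trans similar_sym by metis
  moreover have "idempath_identified \<iota> C H"
    using isomorphic_idempath_identified[OF H(2) X_graphD(1)[OF H(1)]]
      core_of_idempath_identified[OF D(2,3)] by blast
  moreover have "retracted H" using isomorphic_retracted[OF H(2,1) K] .
  ultimately show "X_graph X H \<and> idempath_identified \<iota> C H \<and> retracted H \<and> H \<simeq> G"
    using H(1) by blast
next
  assume H: "X_graph X H \<and> idempath_identified \<iota> C H \<and> retracted H \<and> H \<simeq> G"
  obtain D where D: "descendant \<iota> C G D" "idempath_identified \<iota> C D"
    using identified_descendant_exists[OF G] .
  have DX: "X_graph X D" using descendant_X_graph[OF D(1) G] .
  obtain K where K: "core_of D K" using core_exists[OF DX] .
  obtain f g where KX: "X_graph X K" "retracted K" by (rule core_ofD[OF DX K])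
  have Ki: "idempath_identified \<iota> C K" using core_of_idempath_identified[OF D(2) K] .
  have "D \<simeq> K" "G \<simeq> D" using similar_core[OF DX K] similar_descendant[OF D(1) G] .
  then have HK: "H \<simeq> K" using H similar_trans by metis
  obtain f g where "morphism H K f g" using similar_imp_morphism[OF HK KX(1) Ki] .
  moreover obtain f' g' where "morphism K H f' g'"
    using similar_imp_morphism[OF similar_sym[OF HK]] H by metis
  ultimately have "isomorphic H K" using retracted_isomorphic H KX by blast
  then show "H \<in> pretzel X \<iota> C G"
    using D K H unfolding pretzel_def iso_type_def by blast
qed

lemma pretzel_nonempty:
  assumes G: "X_graph X G"
  shows "pretzel X \<iota> C G \<noteq> {}"
proof -
  obtain D where D: "descendant \<iota> C G D" "idempath_identified \<iota> C D"
    using identified_descendant_exists[OF G] .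
  have DX: "X_graph X D" using descendant_X_graph[OF D(1) G] .
  obtain K where K: "core_of D K" using core_exists[OF DX] .
  obtain f g where KX: "X_graph X K" by (rule core_ofD[OF DX K])
  obtain K' :: "(nat, nat, 'x) xgraph" where "X_graph X K'" "isomorphic K' K"
    using isomorphic_nat_copy[OF KX] .
  then show ?thesis using D K unfolding pretzel_def iso_type_def by blast
qed

lemma pretzel_eq_iff:
  assumes "X_graph X G" "X_graph X H"
  shows "pretzel X \<iota> C G = pretzel X \<iota> C H \<longleftrightarrow> G \<simeq> H"
proof
  assume eq: "pretzel X \<iota> C G = pretzel X \<iota> C H"
  obtain K where "K \<in> pretzel X \<iota> C G" using pretzel_nonempty[OF assms(1)] by blast
  then have "K \<simeq> G" "K \<simeq> H" using eq assms in_pretzel_iff by blast+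
  then show "G \<simeq> H" using similar_sym similar_trans by metis
next
  assume eq: "G \<simeq> H"
  have "K \<simeq> G \<longleftrightarrow> K \<simeq> H" for K :: "(nat, nat, 'x) xgraph"
    using eq similar_sym similar_trans by metis
  then show "pretzel X \<iota> C G = pretzel X \<iota> C H" using in_pretzel_iff[OF assms(1)]
      in_pretzel_iff[OF assms(2)] by blast
qed

text \<open>
  Needed for the identity element, which is given as an isomorphism type.
\<close>

lemma iso_type_eq_pretzel:
  fixes G :: "(nat, nat, 'x) xgraph"
  assumes G: "X_graph X G" "idempath_identified \<iota> C G" "retracted G"
  shows "iso_type X G = pretzel X \<iota> C G"
proof (intro equalityI subsetI)
  fix H assume "H \<in> iso_type X G"
  then have H: "X_graph X H" "isomorphic H G" by (auto simp: iso_type_def)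
  then show "H \<in> pretzel X \<iota> C G"
    using in_pretzel_iff[OF G(1)] similar_if_isomorphic[OF H(2,1)] isomorphic_retracted[OF H(2,1) G(3)]
      isomorphic_idempath_identified[OF H(2) X_graphD(1)[OF H(1)] G(2)] by blast
next
  fix H assume "H \<in> pretzel X \<iota> C G"
  then have H: "X_graph X H" "idempath_identified \<iota> C H" "retracted H" "H \<simeq> G"
    using in_pretzel_iff[OF G(1)] by blast+
  obtain f g where m: "morphism H G f g" using similar_imp_morphism[OF H(4) G(1,2)] .
  obtain f' g' where m': "morphism G H f' g'"
    using similar_imp_morphism[OF similar_sym[OF H(4)] H(1,2)] .
  show "H \<in> iso_type X G"
    using retracted_isomorphic[OF H(1,3) G(1,3) m m'] H(1) by (simp add: iso_type_def)
qed

text \<open>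
  Together with the next lemma, this makes the operations on pretzels independent of the
  representatives.
\<close>

lemma similar_times:
  assumes "X_graph X G" "X_graph X H" "X_graph X G'" "X_graph X H'" "G \<simeq> G'" "H \<simeq> H'"
  shows "graph_times G H \<simeq> graph_times G' H'"
  using assms by (simp add: similar_def end_pairs_times)

lemma similar_plus: "G \<simeq> G' \<Longrightarrow> graph_plus G \<simeq> graph_plus G'"
  by (simp add: similar_def end_pairs_plus)

lemma mult_pretzels:
  assumes "X_graph X G" "X_graph X H"
  shows "pretzel X \<iota> C G \<otimes>\<^bsub>PT X \<iota> C\<^esub> pretzel X \<iota> C H = pretzel X \<iota> C (graph_times G H)"
proof -
  have "pretzel X \<iota> C (graph_times G' H') = pretzel X \<iota> C (graph_times G H)"
    if "G' \<in> pretzel X \<iota> C G" "H' \<in> pretzel X \<iota> C H" for G' H'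
  proof -
    have *: "X_graph X G'" "G' \<simeq> G" "X_graph X H'" "H' \<simeq> H"
      using that in_pretzel_iff assms by blast+
    then show ?thesis
      using similar_times pretzel_eq_iff X_graph_times assms by metis
  qed
  then show ?thesis
    using pretzel_nonempty[OF assms(1)] pretzel_nonempty[OF assms(2)] by (auto simp: PT_def)
qed

lemma uplus_pretzel:
  assumes "X_graph X G"
  shows "uplus (PT X \<iota> C) (pretzel X \<iota> C G) = pretzel X \<iota> C (graph_plus G)"
proof -
  have "pretzel X \<iota> C (graph_plus G') = pretzel X \<iota> C (graph_plus G)"
    if "G' \<in> pretzel X \<iota> C G" for G'
  proof -
    have *: "X_graph X G'" "G' \<simeq> G" using that in_pretzel_iff assms by blast+
    then show ?thesis using similar_plus pretzel_eq_iff X_graph_plus assms by metis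
  qed
  then show ?thesis using pretzel_nonempty[OF assms] by (auto simp: PT_def)
qed

lemma one_pretzel: "\<one>\<^bsub>PT X \<iota> C\<^esub> = pretzel X \<iota> C trivial_graph"
proof -
  have "retracted trivial_graph"
    by (auto simp: retracted_def retract_def morphism_def trivial_graph_def)
  moreover have "idempath_identified \<iota> C trivial_graph"
  proof -
    have "wf_digraph (dgraph trivial_graph)" using X_graphD(1)[OF X_graph_trivial] .
    from idempath_in_verts[OF this] show ?thesis
      by (fastforce simp: idempath_identified_def trivial_graph_def)
  qed
  ultimately show ?thesis using iso_type_eq_pretzel[OF X_graph_trivial] by (simp add: PT_def)
qed

end

section \<open>Trees have at most one arc into each vertex\<close>

text \<open>
  A local description of \<open>X\<close>-trees; given that all vertices are reachable from the start vertex, it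
  excludes undirected cycles.
\<close>

definition arborescence :: "'x set \<Rightarrow> ('v, 'e, 'x) xgraph \<Rightarrow> bool" where
  "arborescence X G \<longleftrightarrow> X_graph X G \<and>
     (\<forall>e\<in>xarcs G. xhead G e \<noteq> start_vertex G) \<and> inj_on (xhead G) (xarcs G)"

lemma walk_snocD:
  assumes "wf_digraph (dgraph G)" "walk G u (p @ [e]) v"
  shows "walk G u p (xtail G e)" "e \<in> xarcs G" "xhead G e = v"
  using assms(2) unfolding wf_digraph.awalk_append_iff[OF assms(1)]
  by (auto simp: wf_digraph.awalk_simps[OF assms(1)])

text \<open>
  A walk can be retraced from its end in only one way, so the shorter walk is a suffix of the longer.
\<close>

lemma walks_to_common_vertex:
  assumes wf: "wf_digraph (dgraph G)" and inj: "inj_on (xhead G) (xarcs G)"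
    and "walk G u p v" "walk G u' p' v"
  shows "(\<exists>z. p = z @ p' \<and> walk G u z u') \<or> (\<exists>z. p' = z @ p \<and> walk G u' z u)"
  using assms(3,4)
proof (induction p arbitrary: v p' rule: rev_induct)
  case Nil
  then show ?case using wf_digraph.awalk_simps(1)[OF wf] by auto
next
  case (snoc e p)
  show ?case
  proof (cases p' rule: rev_cases)
    case Nil
    then show ?thesis using snoc.prems wf_digraph.awalk_simps(1)[OF wf] by auto
  next
    case (snoc q e')
    note e = walk_snocD[OF wf \<open>walk G u (p @ [e]) v\<close>]
      walk_snocD[OF wf \<open>walk G u' p' v\<close>[unfolded snoc]]
    have "e = e'" using e inj by (metis inj_onD)
    then show ?thesis using snoc.IH[of "xtail G e" q] e snoc by auto
  qed
qed

text \<open>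
  Let \<open>q\<close> lead from the root to \<open>v\<close>. For a closed walk \<open>p\<close> at \<open>v\<close>, one of the walks \<open>q\<close> and \<open>q @ p\<close> is a
  suffix of the other, and the part in front of it is a closed walk at the root, which no arc enters.
\<close>

lemma arborescence_walk_unique:
  assumes G: "arborescence X G"
  shows closed_walk_Nil: "walk G v p v \<Longrightarrow> p = []"
    and walk_unique: "walk G u p v \<Longrightarrow> walk G u p' v \<Longrightarrow> p = p'"
proof -
  have X: "X_graph X G" and root: "\<forall>e\<in>xarcs G. xhead G e \<noteq> start_vertex G"
    and inj: "inj_on (xhead G) (xarcs G)" using G by (auto simp: arborescence_def)
  note wf = X_graphD(1)[OF X]
  have to_root: "z = []" if "walk G w z (start_vertex G)" for w z
  proof (cases z rule: rev_cases)
    case (snoc y e)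
    then show ?thesis using walk_snocD[OF wf] that root by metis
  qed
  have closed: "p = []" if p: "walk G v p v" for v p
  proof -
    obtain q where q: "walk G (start_vertex G) q v"
      using X_graphD(7)[OF X] wf_digraph.awalk_last_in_verts[OF wf p] by blast
    have qp: "walk G (start_vertex G) (q @ p) v" using wf_digraph.awalk_appendI[OF wf q p] .
    from walks_to_common_vertex[OF wf inj q qp] show ?thesis
    proof
      assume "\<exists>z. q = z @ (q @ p) \<and> walk G (start_vertex G) z (start_vertex G)"
      then obtain z where "q = z @ (q @ p)" by blast
      from arg_cong[OF this, of length] show ?thesis by simp
    next
      assume "\<exists>z. q @ p = z @ q \<and> walk G (start_vertex G) z (start_vertex G)"
      then obtain z where "q @ p = z @ q" "z = []" using to_root by blast
      from arg_cong[OF this(1), of length] this(2) show ?thesis by simp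
    qed
  qed
  then show "walk G v p v \<Longrightarrow> p = []" .
  show "p = p'" if "walk G u p v" "walk G u p' v"
    using walks_to_common_vertex[OF wf inj that] closed by fastforce
qed

subsection \<open>Undirected walks\<close>

lemma bidirected_simps:
  "verts (bidirected D) = verts D" "arcs (bidirected D) = arcs D \<times> UNIV"
  "tail (bidirected D) (e, b) = (if b then tail D e else head D e)"
  "head (bidirected D) (e, b) = (if b then head D e else tail D e)"
  by (auto simp: bidirected_def)

lemma wf_bidirected: "wf_digraph D \<Longrightarrow> wf_digraph (bidirected D)"
  by (auto simp: wf_digraph_def bidirected_simps)

definition reverse_walk :: "('e \<times> bool) list \<Rightarrow> ('e \<times> bool) list" where
  "reverse_walk p = rev (map (\<lambda>(e, b). (e, \<not> b)) p)"

definition no_backtrack :: "('e \<times> bool) list \<Rightarrow> bool" where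
  "no_backtrack p = successively (\<lambda>x y. fst x = fst y \<longrightarrow> snd x = snd y) p"

lemma awalk_reverse:
  assumes wf: "wf_digraph D" and "pre_digraph.awalk (bidirected D) u p v"
  shows "pre_digraph.awalk (bidirected D) v (reverse_walk p) u"
  using assms(2)
proof (induction p arbitrary: u)
  case Nil
  then show ?case
    using wf_digraph.awalk_simps(1)[OF wf_bidirected[OF wf]] by (auto simp: reverse_walk_def)
next
  case (Cons x p)
  obtain e b where x: "x = (e, b)" by (cases x)
  note simps = wf_digraph.awalk_simps[OF wf_bidirected[OF wf]] bidirected_simps
  have e: "e \<in> arcs D" "u = (if b then tail D e else head D e)"
    "pre_digraph.awalk (bidirected D) (if b then head D e else tail D e) p v"
    using Cons.prems by (auto simp: x simps)
  have "pre_digraph.awalk (bidirected D) (if b then head D e else tail D e) [(e, \<not> b)] u"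
    using e wf by (auto simp: simps wf_digraph_def)
  from wf_digraph.awalk_appendI[OF wf_bidirected[OF wf] Cons.IH[OF e(3)] this]
  show ?case by (simp add: reverse_walk_def x)
qed

lemma no_backtrack_reverse: "no_backtrack p \<Longrightarrow> no_backtrack (reverse_walk p)"
  by (auto simp: no_backtrack_def reverse_walk_def successively_map case_prod_beta
      elim!: successively_mono)

lemma no_backtrack_apath:
  assumes wf: "wf_digraph D" and "pre_digraph.apath (bidirected D) u p v"
  shows "no_backtrack p"
  using assms(2)
proof (induction p arbitrary: u)
  case (Cons x p)
  note simps = wf_digraph.apath_Cons_iff[OF wf_bidirected[OF wf]]
  show ?case
  proof (cases p)
    case Nil then show ?thesis by (simp add: no_backtrack_def)
  next
    case y: (Cons y q)
    have "snd x = snd y" if "fst x = fst y"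
    proof (rule ccontr)
      assume "snd x \<noteq> snd y"
      then have "head (bidirected D) y = tail (bidirected D) x"
        using that by (cases x; cases y) (auto simp: bidirected_simps)
      moreover have "head (bidirected D) y \<in> set (pre_digraph.awalk_verts (bidirected D) (head (bidirected D) y) q)"
        using Cons.prems wf_digraph.hd_in_awalk_verts(2)[OF wf_bidirected[OF wf], of "head (bidirected D) y" q v]
        by (simp add: y simps)
      ultimately show False using Cons.prems
        by (simp add: y simps pre_digraph.awalk_verts.simps)
    qed
    moreover have "no_backtrack p" using Cons.IH[of "head (bidirected D) x"] Cons.prems by (simp add: simps)
    ultimately show ?thesis by (simp add: y no_backtrack_def)
  qed
qed (simp add: no_backtrack_def)

lemma map_eq_append_Cons:
  assumes "map f p = xs @ y # ys"
  obtains q x r where "p = q @ x # r" "f x = y" "map f r = ys"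
proof -
  obtain q p' where "p = q @ p'" "map f p' = y # ys"
    using assms unfolding map_eq_append_conv by auto
  then show ?thesis using that by (cases p') auto
qed

text \<open>
  A shortest nonempty closed subwalk visits no vertex twice. If it used an arc twice, the two passes
  would have opposite directions and, as they are not consecutive, a vertex would be repeated.
\<close>

lemma closed_walk_contains_cycle:
  assumes wf: "wf_digraph D" and "pre_digraph.awalk (bidirected D) u p u" "p \<noteq> []" "no_backtrack p"
  shows "\<exists>c. pre_digraph.cycle (bidirected D) c \<and> distinct (map fst c)"
  using assms(2-)
proof (induction "length p" arbitrary: u p rule: less_induct)
  case less
  interpret B: wf_digraph "bidirected D" using wf_bidirected[OF wf] .
  show ?case
  proof (cases "distinct (tl (B.awalk_verts u p))")
    case True
    have heads: "distinct (map (head (bidirected D)) p)"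
      using True B.awalk_verts_conv' less.prems(1,2) unfolding B.awalk_def by auto
    have "distinct (map fst p)"
    proof (rule ccontr)
      assume "\<not> distinct (map fst p)"
      then obtain xs y ys zs where split: "map fst p = xs @ y # ys @ y # zs"
        using not_distinct_decomp[of "map fst p"] by auto
      obtain q x p' where "p = q @ x # p'" "fst x = y" and split': "map fst p' = ys @ y # zs"
        using map_eq_append_Cons[OF split] .
      moreover obtain r x' s where "p' = r @ x' # s" "fst x' = y"
        using map_eq_append_Cons[OF split'] .
      ultimately obtain b b' where p: "p = q @ (y, b) # r @ (y, b') # s"
        by (cases x, cases x') auto
      have "b \<noteq> b'" using heads unfolding p by auto
      then have "r \<noteq> []"
        using less.prems(3) unfolding p no_backtrack_def by (auto simp: successively_append_iff)
      then obtain r' x where r: "r = r' @ [x]" by (cases r rule: rev_cases) auto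
      have "head (bidirected D) x = tail (bidirected D) (y, b')"
        using less.prems(1) unfolding p r B.awalk_def by (auto simp: B.awalk_verts_conv)
      also have "\<dots> = head (bidirected D) (y, b)" using \<open>b \<noteq> b'\<close> by (simp add: bidirected_simps)
      finally show False using heads unfolding p r by simp
    qed
    moreover have "B.cycle p" using True less.prems unfolding B.cycle_def by blast
    ultimately show ?thesis by blast
  next
    case False
    obtain x p' where x: "p = x # p'" using less.prems(2) by (cases p) auto
    have "B.awalk (head (bidirected D) x) p' u" "\<not> distinct (B.awalk_verts (head (bidirected D) x) p')"
      using less.prems(1) False unfolding x by (auto simp: B.awalk_Cons_iff)
    from B.awalk_not_distinct_decomp[OF this] obtain q r s w
      where r: "p' = q @ r @ s" "0 < length r" "B.awalk w r w" by blast
    have "no_backtrack r"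
      using less.prems(3) unfolding x r(1) no_backtrack_def by (auto simp: successively_append_iff successively_Cons)
    then show ?thesis using less.hyps[of r w] r x by auto
  qed
qed

text \<open>
  Two different arcs into one vertex would give a closed undirected walk without backtracking: out
  through one arc and back through the other. An arc into the root would give one as well.
\<close>

lemma X_tree_imp_arborescence:
  assumes T: "X_tree X G"
  shows "arborescence X G"
proof -
  have X: "X_graph X G" and acyclic: "\<And>c. pre_digraph.cycle (bidirected (dgraph G)) c \<Longrightarrow> \<not> distinct (map fst c)"
    and away: "\<And>e. e \<in> xarcs G \<Longrightarrow> \<exists>p. pre_digraph.apath (bidirected (dgraph G)) (start_vertex G) p (xtail G e) \<and>
        e \<notin> fst ` set p"
    using T by (auto simp: X_tree_def undirected_tree_def)
  note wf = X_graphD(1)[OF X]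
  interpret B: wf_digraph "bidirected (dgraph G)" using wf_bidirected[OF wf] .
  have no_closed: "p = []" if "B.awalk u p u" "no_backtrack p" for u p
    using closed_walk_contains_cycle[OF wf that(1) _ that(2)] acyclic by blast
  have path: "\<exists>p. B.awalk (start_vertex G) (p @ [(e, True)]) (xhead G e) \<and> no_backtrack (p @ [(e, True)])"
    if e: "e \<in> xarcs G" for e
  proof -
    obtain p where p: "B.apath (start_vertex G) p (xtail G e)" "e \<notin> fst ` set p"
      using away[OF e] by blast
    have "B.awalk (xtail G e) [(e, True)] (xhead G e)"
      using e X_graphD(9)[OF X e] by (simp add: B.awalk_simps bidirected_simps)
    then have "B.awalk (start_vertex G) (p @ [(e, True)]) (xhead G e)"
      using p(1) B.awalk_appendI B.awalkI_apath by blast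
    moreover have "no_backtrack (p @ [(e, True)])"
      using no_backtrack_apath[OF wf p(1)] p(2)
      by (cases p rule: rev_cases) (auto simp: no_backtrack_def successively_append_iff)
    ultimately show ?thesis by blast
  qed
  have "xhead G e \<noteq> start_vertex G" if e: "e \<in> xarcs G" for e
  proof
    assume "xhead G e = start_vertex G"
    then obtain p where "B.awalk (start_vertex G) (p @ [(e, True)]) (start_vertex G)"
      "no_backtrack (p @ [(e, True)])" using path[OF e] by auto
    then show False using no_closed by blast
  qed
  moreover have "e = e'" if e: "e \<in> xarcs G" "e' \<in> xarcs G" "xhead G e = xhead G e'" for e e'
  proof (rule ccontr)
    assume "e \<noteq> e'"
    obtain p where p: "B.awalk (start_vertex G) (p @ [(e, True)]) (xhead G e)"
      "no_backtrack (p @ [(e, True)])" using path[OF e(1)] by blast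
    obtain q where q: "B.awalk (start_vertex G) (q @ [(e', True)]) (xhead G e)"
      "no_backtrack (q @ [(e', True)])" using path[OF e(2)] e(3) by auto
    let ?r = "(p @ [(e, True)]) @ reverse_walk (q @ [(e', True)])"
    have "B.awalk (start_vertex G) ?r (start_vertex G)"
      using B.awalk_appendI[OF p(1) awalk_reverse[OF wf q(1)]] .
    moreover have "no_backtrack ?r"
      using p(2) no_backtrack_reverse[OF q(2)] \<open>e \<noteq> e'\<close>
      unfolding no_backtrack_def successively_append_iff[of _ "p @ [(e, True)]"]
      by (auto simp: reverse_walk_def)
    ultimately show False using no_closed by blast
  qed
  ultimately show ?thesis using X unfolding arborescence_def inj_on_def by blast
qed

text \<open>
  A backward step after a forward step would traverse a second arc into the same vertex.
\<close>

lemma arborescence_downward_walk: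
  assumes G: "arborescence X G"
    and "pre_digraph.awalk (bidirected (dgraph G)) u ((e, True) # p) v"
    and "distinct (map fst ((e, True) # p))"
  shows "walk G u (map fst ((e, True) # p)) v"
  using assms(2,3)
proof (induction p arbitrary: u e)
  case Nil
  have "X_graph X G" using G by (simp add: arborescence_def)
  note wf = X_graphD(1)[OF this]
  show ?case using Nil
    by (auto simp: wf_digraph.awalk_simps[OF wf] wf_digraph.awalk_simps[OF wf_bidirected[OF wf]] bidirected_simps)
next
  case (Cons x p)
  have X: "X_graph X G" and inj: "inj_on (xhead G) (xarcs G)" using G by (simp_all add: arborescence_def)
  note wf = X_graphD(1)[OF X]
  note simps = wf_digraph.awalk_simps[OF wf] wf_digraph.awalk_simps[OF wf_bidirected[OF wf]] bidirected_simps
  obtain e' b where x: "x = (e', b)" by (cases x)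
  have e: "e \<in> xarcs G" "e' \<in> xarcs G" "e \<noteq> e'" "u = xtail G e"
    "xhead G e = (if b then xtail G e' else xhead G e')" 
    using Cons.prems by (auto simp: simps x)
  have b
  proof (rule ccontr)
    assume "\<not> b"
    then show False using e inj by (auto dest: inj_onD)
  qed
  have "walk G (xhead G e) (map fst ((e', True) # p)) v"
    using Cons.IH[of "xhead G e" e'] Cons.prems \<open>b\<close> by (simp add: x simps)
  then show ?case using e \<open>b\<close> by (simp add: simps x)
qed

text \<open>
  By the previous lemma and reversal, a cycle can neither begin with a forward step nor end with a
  backward one. So its first and its last arc both enter its base vertex and thus coincide.
\<close>

lemma arborescence_imp_X_tree:
  assumes G: "arborescence X G"
  shows "X_tree X G"
proof -
  have X: "X_graph X G" and inj: "inj_on (xhead G) (xarcs G)" using G by (simp_all add: arborescence_def)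
  note wf = X_graphD(1)[OF X]
  interpret W: wf_digraph "dgraph G" using wf .
  interpret B: wf_digraph "bidirected (dgraph G)" using wf_bidirected[OF wf] .
  have "\<not> distinct (map fst c)" if cyc: "B.cycle c" for c
  proof
    assume d: "distinct (map fst c)"
    obtain u where u: "B.awalk u c u" "c \<noteq> []" using cyc by (auto simp: B.cycle_def)
    have up: "\<not> snd (hd p)" if p: "B.awalk u p u" "p \<noteq> []" "distinct (map fst p)" for p
    proof
      assume "snd (hd p)"
      then obtain e q where eq: "p = (e, True) # q" using p(2) by (cases p) auto
      have "walk G u (map fst ((e, True) # q)) u"
        using arborescence_downward_walk[OF G, of u e q u] p unfolding eq by blast
      from closed_walk_Nil[OF G this] show False by simp
    qed
    have "\<not> snd (hd c)" using up u d by blast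
    moreover have "\<not> snd (hd (reverse_walk c))"
      using up[of "reverse_walk c"] awalk_reverse[OF wf u(1)] u(2) d
      by (simp add: reverse_walk_def rev_map[symmetric] comp_def case_prod_beta)
    then have "snd (last c)" using u(2) by (simp add: reverse_walk_def hd_rev last_map case_prod_beta)
    ultimately obtain e q e' where c: "c = (e, False) # q @ [(e', True)]"
      using u(2) by (cases c; cases "tl c" rule: rev_cases; auto split: if_splits)
    have "e \<in> xarcs G" "e' \<in> xarcs G" "xhead G e = u" "xhead G e' = u"
      using u(1) unfolding c by (auto simp: B.awalk_simps bidirected_simps)
    then have "e = e'" using inj by (metis inj_onD)
    then show False using d c by simp
  qed
  moreover have "Digraph_Component.connected (dgraph G)"
    unfolding connected_def strongly_connected_def
  proof (intro conjI ballI)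
    let ?S = "with_proj (mk_symmetric (dgraph G))"
    show "verts ?S \<noteq> {}" using X_graphD(5)[OF X] by auto
    have root: "start_vertex G \<rightarrow>\<^sup>*\<^bsub>?S\<^esub> w" if "w \<in> verts ?S" for w
      using that X X_graph_def[of X G] by (intro W.reachable_mk_symmetricI) auto
    interpret S: pair_wf_digraph "mk_symmetric (dgraph G)" by (rule W.wellformed_mk_symmetric)
    fix u v assume u: "u \<in> verts ?S" and v: "v \<in> verts ?S"
    show "u \<rightarrow>\<^sup>*\<^bsub>?S\<^esub> v"
      by (rule S.reachable_trans[OF symmetric_reachable[OF symmetric_mk_symmetric root[OF u]] root[OF v]])
  qed
  moreover have "\<exists>p. B.apath (start_vertex G) p (xtail G e) \<and> e \<notin> fst ` set p"
    if e: "e \<in> xarcs G" for e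
  proof -
    obtain p where p: "walk G (start_vertex G) p (xtail G e)"
      using X_graphD(7)[OF X X_graphD(8)[OF X e]] by blast
    let ?p = "map (\<lambda>e. (e, True)) p"
    have "B.awalk u (map (\<lambda>e. (e, True)) p) v \<and>
        B.awalk_verts u (map (\<lambda>e. (e, True)) p) = W.awalk_verts u p" if "W.awalk u p v" for u p v
      using that by (induction p arbitrary: u) (auto simp: W.awalk_simps B.awalk_simps bidirected_simps)
    from this[OF p] have p': "B.awalk (start_vertex G) ?p (xtail G e)"
      "B.awalk_verts (start_vertex G) ?p = W.awalk_verts (start_vertex G) p" by auto
    have "distinct (W.awalk_verts (start_vertex G) p)"
      using W.awalk_not_distinct_decomp[OF p] closed_walk_Nil[OF G] by auto
    moreover have "e \<notin> set p"
    proof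
      assume "e \<in> set p"
      then obtain q r where "p = q @ e # r" by (auto simp: in_set_conv_decomp)
      then have "walk G (xtail G e) (e # r) (xtail G e)"
        using p e by (auto simp: W.awalk_simps)
      then show False using closed_walk_Nil[OF G] by blast
    qed
    ultimately show ?thesis using p' by (intro exI[of _ ?p]) (auto simp: B.apath_def)
  qed
  ultimately show ?thesis using X unfolding X_tree_def undirected_tree_def by blast
qed

subsection \<open>Closure properties\<close>

text \<open>
  Applies to cores and to isomorphic copies.
\<close>

lemma arborescence_if_embeds:
  assumes "arborescence X G" "X_graph X H" "morphism H G f g" "inj_on g (xarcs H)"
  shows "arborescence X H"
  unfolding arborescence_def
proof (intro conjI ballI inj_onI)
  fix e assume "e \<in> xarcs H"
  then have "g e \<in> xarcs G" "xhead G (g e) = f (xhead H e)" "f (start_vertex H) = start_vertex G"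
    using assms(3) by (auto simp: morphism_def)
  then show "xhead H e \<noteq> start_vertex H" using assms(1) unfolding arborescence_def by metis
next
  fix e e' assume *: "e \<in> xarcs H" "e' \<in> xarcs H" "xhead H e = xhead H e'"
  then have "g e \<in> xarcs G" "g e' \<in> xarcs G" "xhead G (g e) = xhead G (g e')"
    using assms(3) by (auto simp: morphism_def)
  then have "g e = g e'" using assms(1) unfolding arborescence_def by (metis inj_onD)
  then show "e = e'" using assms(4) * by (metis inj_onD)
qed (rule assms(2))

lemma arborescence_plus: "arborescence X G \<Longrightarrow> arborescence X (graph_plus G)"
  using X_graph_plus by (auto simp: arborescence_def graph_plus_def)

lemma arborescence_trivial: "arborescence X trivial_graph"
  using X_graph_trivial by (auto simp: arborescence_def trivial_graph_def)

lemma arborescence_edge: "x \<in> X \<Longrightarrow> arborescence X (edge_tree x)"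
  using X_graph_edge by (auto simp: arborescence_def edge_tree_def)

lemma arborescence_times:
  assumes G: "arborescence X G" and H: "arborescence X H"
  shows "arborescence X (graph_times G H)"
proof -
  have r: "xhead (graph_times G H) (Inr e) = Inr (xhead H e)" if "e \<in> xarcs H" for e
    using H that by (simp add: arborescence_def graph_times_simps glue_def)
  have "xhead (graph_times G H) e \<noteq> start_vertex (graph_times G H)"
    if "e \<in> xarcs (graph_times G H)" for e
    using that G by (cases e) (auto simp: arborescence_def graph_times_simps(2,4,9) r)
  moreover have "e = e'"
    if "e \<in> xarcs (graph_times G H)" "e' \<in> xarcs (graph_times G H)"
      "xhead (graph_times G H) e = xhead (graph_times G H) e'" for e e'
    using that G H
    by (cases e; cases e') (auto simp: arborescence_def graph_times_simps(2,4) r dest: inj_onD)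
  ultimately show ?thesis
    using G H X_graph_times unfolding arborescence_def by (blast intro: inj_onI)
qed

section \<open>Walk values in descendants of trees\<close>

context pretzels
begin

lemma monoid_C: "monoid C"
  and letter_closed: "x \<in> X \<Longrightarrow> \<iota> x \<in> carrier C"
  using generated by (auto simp: generated_monoid_def)

sublocale C: monoid C by (rule monoid_C)

lemma right_cancel:
  "a \<in> carrier C \<Longrightarrow> b \<in> carrier C \<Longrightarrow> c \<in> carrier C \<Longrightarrow> a \<otimes>\<^bsub>C\<^esub> c = b \<otimes>\<^bsub>C\<^esub> c \<Longrightarrow> a = b"
  using cancel by (auto simp: right_cancellative_def)

text \<open>
  \<open>(b a) b = b (a b) = 1 b\<close>; now cancel \<open>b\<close>.
\<close>

lemma one_sided_inverse_commutes:
  assumes "a \<in> carrier C" "b \<in> carrier C" "a \<otimes>\<^bsub>C\<^esub> b = \<one>\<^bsub>C\<^esub>"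
  shows "b \<otimes>\<^bsub>C\<^esub> a = \<one>\<^bsub>C\<^esub>"
proof (rule right_cancel)
  show "(b \<otimes>\<^bsub>C\<^esub> a) \<otimes>\<^bsub>C\<^esub> b = \<one>\<^bsub>C\<^esub> \<otimes>\<^bsub>C\<^esub> b" using assms by (simp add: C.m_assoc)
qed (use assms in auto)

lemma word_value_simps:
  "word_value \<iota> C [] = \<one>\<^bsub>C\<^esub>" "word_value \<iota> C (x # w) = \<iota> x \<otimes>\<^bsub>C\<^esub> word_value \<iota> C w"
  by (simp_all add: word_value_def)

lemma word_value_closed: "set w \<subseteq> X \<Longrightarrow> word_value \<iota> C w \<in> carrier C"
  by (induction w) (auto simp: word_value_simps letter_closed)

lemma word_value_append:
  "set w \<subseteq> X \<Longrightarrow> set w' \<subseteq> X \<Longrightarrow> word_value \<iota> C (w @ w') = word_value \<iota> C w \<otimes>\<^bsub>C\<^esub> word_value \<iota> C w'"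
  by (induction w) (auto simp: word_value_simps letter_closed word_value_closed C.m_assoc)

definition walk_value :: "('v, 'e, 'x) xgraph \<Rightarrow> 'v \<Rightarrow> 'c \<Rightarrow> 'v \<Rightarrow> bool" where
  "walk_value G u c v \<longleftrightarrow> (\<exists>p. walk G u p v \<and> word_value \<iota> C (map (label G) p) = c)"

lemma walk_valueI: "walk G u p v \<Longrightarrow> walk_value G u (word_value \<iota> C (map (label G) p)) v"
  by (auto simp: walk_value_def)

lemma walk_value_one_iff: "walk_value G u \<one>\<^bsub>C\<^esub> v \<longleftrightarrow> (\<exists>p. idempath \<iota> C G u p v)"
  by (simp add: walk_value_def idempath_def)

lemma walk_labels: "X_graph X G \<Longrightarrow> walk G u p v \<Longrightarrow> set (map (label G) p) \<subseteq> X"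
  using X_graphD(4)[of X G] by (auto simp: pre_digraph.awalk_def)

lemma walk_value_closed:
  assumes "X_graph X G" "walk_value G u c v"
  shows "c \<in> carrier C" "u \<in> xverts G" "v \<in> xverts G"
  using assms word_value_closed walk_labels wf_digraph.awalk_hd_in_verts[OF X_graphD(1)]
    wf_digraph.awalk_last_in_verts[OF X_graphD(1)]
  unfolding walk_value_def by metis+

lemma walk_value_refl: "u \<in> xverts G \<Longrightarrow> walk_value G u \<one>\<^bsub>C\<^esub> u"
  unfolding walk_value_def
  by (rule exI[of _ "[]"]) (simp add: pre_digraph.awalk_def pre_digraph.cas.simps word_value_simps)

lemma walk_value_trans:
  assumes G: "X_graph X G" and "walk_value G u c v" "walk_value G v d w"
  shows "walk_value G u (c \<otimes>\<^bsub>C\<^esub> d) w"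
proof -
  obtain p q where p: "walk G u p v" "word_value \<iota> C (map (label G) p) = c"
    "walk G v q w" "word_value \<iota> C (map (label G) q) = d"
    using assms by (auto simp: walk_value_def)
  have "word_value \<iota> C (map (label G) (p @ q)) = c \<otimes>\<^bsub>C\<^esub> d"
    using word_value_append[OF walk_labels[OF G p(1)] walk_labels[OF G p(3)]] p by simp
  then show ?thesis
    using wf_digraph.awalk_appendI[OF X_graphD(1)[OF G] p(1,3)] unfolding walk_value_def by blast
qed

lemma walk_value_hom:
  "graph_hom G K f g \<Longrightarrow> walk_value G u c v \<Longrightarrow> walk_value K (f u) c (f v)"
  unfolding walk_value_def using graph_hom_walk by metis

text \<open>
  The invariant that descendants inherit from trees.
\<close>

definition coherent :: "('v, 'e, 'x) xgraph \<Rightarrow> bool" where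
  "coherent G \<longleftrightarrow>
     (\<forall>u v c d. walk_value G u c v \<longrightarrow> walk_value G u d v \<longrightarrow> c = d) \<and>
     (\<forall>u u' v c d. walk_value G u c v \<longrightarrow> walk_value G u' d v \<longrightarrow>
        (\<exists>b. walk_value G u b u') \<or> (\<exists>b. walk_value G u' b u))"

lemma coherentD:
  assumes "coherent G"
  shows "walk_value G u c v \<Longrightarrow> walk_value G u d v \<Longrightarrow> c = d"
    and "walk_value G u c v \<Longrightarrow> walk_value G u' d v \<Longrightarrow>
        (\<exists>b. walk_value G u b u') \<or> (\<exists>b. walk_value G u' b u)"
  using assms unfolding coherent_def by blast+

lemma coherent_arborescence:
  assumes G: "arborescence X G"
  shows "coherent G"
  unfolding coherent_def
proof (intro conjI allI impI)
  fix u v c d assume "walk_value G u c v" "walk_value G u d v"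
  then show "c = d" using walk_unique[OF G] unfolding walk_value_def by metis
next
  fix u u' v c d assume "walk_value G u c v" "walk_value G u' d v"
  then obtain p p' where p: "walk G u p v" "walk G u' p' v" unfolding walk_value_def by blast
  have "wf_digraph (dgraph G)" "inj_on (xhead G) (xarcs G)"
    using G X_graphD(1) by (auto simp: arborescence_def)
  from walks_to_common_vertex[OF this p]
  show "(\<exists>b. walk_value G u b u') \<or> (\<exists>b. walk_value G u' b u)" by (auto intro: walk_valueI)
qed

text \<open>
  A walk in the quotient is a sequence of walks of \<open>G\<close> separated by jumps between \<open>u\<close> and \<open>v\<close>. A jump from
  \<open>u\<close> to \<open>v\<close> is replaced by the idempath. Two successive jumps from \<open>v\<close> to \<open>u\<close> enclose a walk from \<open>u\<close> to
  \<open>v\<close>, which by coherence has value \<open>1\<close> and can be omitted. Hence one jump from \<open>v\<close> to \<open>u\<close> is enough.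
\<close>

lemma walk_value_identify:
  assumes G: "X_graph X G" and coh: "coherent G" and uv: "walk_value G u \<one>\<^bsub>C\<^esub> v"
    and w: "walk_value (identify u v G) a c b"
  obtains "walk_value G a c b"
    | c1 c2 where "c = c1 \<otimes>\<^bsub>C\<^esub> c2" "walk_value G a c1 v" "walk_value G u c2 b"
proof -
  let ?K = "identify u v G"
  note wf = X_graphD(1)[OF identify_X_graph[OF G]]
  note W = walk_value_closed[OF G]
  have "walk_value G a (word_value \<iota> C (map (label G) p)) b \<or>
    (\<exists>c1 c2. word_value \<iota> C (map (label G) p) = c1 \<otimes>\<^bsub>C\<^esub> c2 \<and> walk_value G a c1 v \<and> walk_value G u c2 b)"
    if "walk ?K a p b" for p
    using that
  proof (induction p arbitrary: a)
    case Nil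
    then have "a = b" "b \<in> xverts G"
      using W(2)[OF uv] by (auto simp: wf_digraph.awalk_simps[OF wf] identify_simps split: if_splits)
    then show ?case using walk_value_refl[of b G] by (simp add: word_value_simps)
  next
    case (Cons e p)
    define d where "d = word_value \<iota> C (map (label G) p)"
    define x where "x = \<iota> (label G e)"
    have e: "e \<in> xarcs G" "a = (if xtail G e = v then u else xtail G e)"
      and p: "walk ?K (if xhead G e = v then u else xhead G e) p b"
      using Cons.prems by (auto simp: wf_digraph.awalk_simps[OF wf] identify_simps)
    have x: "x \<in> carrier C" using X_graphD(4)[OF G e(1)] letter_closed by (simp add: x_def)
    have "walk_value G (xtail G e) x (xhead G e)"
      using walk_valueI[OF wf_digraph.arc_implies_awalk[OF X_graphD(1)[OF G] e(1)]] x
      by (simp add: word_value_simps x_def)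
    then have ax: "walk_value G a x (xhead G e)"
      using walk_value_trans[OF G uv, of x] x e(2) by (auto split: if_splits)
    have val: "word_value \<iota> C (map (label G) (e # p)) = x \<otimes>\<^bsub>C\<^esub> d"
      by (simp add: word_value_simps x_def d_def)
    consider (plain) "walk_value G (if xhead G e = v then u else xhead G e) d b"
      | (jump) c1 c2 where "d = c1 \<otimes>\<^bsub>C\<^esub> c2"
        "walk_value G (if xhead G e = v then u else xhead G e) c1 v" "walk_value G u c2 b"
      using Cons.IH[OF p] unfolding d_def by blast
    then show ?case
    proof cases
      case plain
      then show ?thesis using walk_value_trans[OF G ax] ax unfolding val by (auto split: if_splits)
    next
      case jump
      note c = W(1)[OF jump(2)] W(1)[OF jump(3)]
      have "\<exists>c1 c2. x \<otimes>\<^bsub>C\<^esub> d = c1 \<otimes>\<^bsub>C\<^esub> c2 \<and> walk_value G a c1 v \<and> walk_value G u c2 b"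
      proof (cases "xhead G e = v")
        case True
        then have "c1 = \<one>\<^bsub>C\<^esub>" using coherentD(1)[OF coh _ uv] jump(2) by simp
        then have "d = c2" using jump(1) c by simp
        then show ?thesis using ax True jump(3) by auto
      next
        case False
        then have "walk_value G a (x \<otimes>\<^bsub>C\<^esub> c1) v" using walk_value_trans[OF G ax] jump(2) by simp
        moreover have "x \<otimes>\<^bsub>C\<^esub> d = (x \<otimes>\<^bsub>C\<^esub> c1) \<otimes>\<^bsub>C\<^esub> c2" using jump(1) x c by (simp add: C.m_assoc)
        ultimately show ?thesis using jump(3) by blast
      qed
      then show ?thesis unfolding val by blast
    qed
  qed
  then show ?thesis using w that unfolding walk_value_def[of ?K] identify_simps(5) by metis
qed

text \<open>
  The crucial case is that of a walk from \<open>a\<close> to \<open>b\<close> in \<open>G\<close> and another one that jumps from \<open>v\<close> to \<open>u\<close>.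
  Both \<open>a\<close> and \<open>u\<close> have walks to \<open>b\<close>, so they are comparable. If \<open>u\<close> comes before \<open>a\<close>, the walks from \<open>u\<close> to
  \<open>a\<close> and from \<open>a\<close> to \<open>v\<close> have values \<open>d\<close> and \<open>c1\<close> with \<open>d c1 = 1\<close>; it is here that \<open>c1 d = 1\<close> is
  needed.
\<close>

lemma coherent_identify:
  assumes G: "X_graph X G" and coh: "coherent G" and uv: "walk_value G u \<one>\<^bsub>C\<^esub> v"
  shows "coherent (identify u v G)"
proof -
  let ?K = "identify u v G"
  note W = walk_value_closed[OF G]
  note trans = walk_value_trans[OF G]
  note unique = coherentD(1)[OF coh]
  note split = walk_value_identify[OF G coh uv]
  note K = identify_X_graph[OF G, of u v]
  have mixed: "c = c1 \<otimes>\<^bsub>C\<^esub> c2"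
    if ab: "walk_value G a c b" and av: "walk_value G a c1 v" and ub: "walk_value G u c2 b"
    for a b c c1 c2
  proof -
    note cl = W(1)[OF ab] W(1)[OF av] W(1)[OF ub]
    from coherentD(2)[OF coh ab ub] show ?thesis
    proof (elim disjE exE)
      fix d assume d: "walk_value G a d u"
      have "d = c1" using unique[OF trans[OF d uv] av] W(1)[OF d] by simp
      then show ?thesis using unique[OF ab trans[OF d ub]] by simp
    next
      fix d assume d: "walk_value G u d a"
      note d' = W(1)[OF d]
      have "d \<otimes>\<^bsub>C\<^esub> c1 = \<one>\<^bsub>C\<^esub>" using unique[OF trans[OF d av] uv] .
      then have "c1 \<otimes>\<^bsub>C\<^esub> d = \<one>\<^bsub>C\<^esub>" using one_sided_inverse_commutes d' cl by blast
      moreover have "c2 = d \<otimes>\<^bsub>C\<^esub> c" using unique[OF ub trans[OF d ab]] .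
      ultimately show ?thesis using cl d' by (simp add: C.m_assoc[symmetric])
    qed
  qed
  have "c = d" if c: "walk_value ?K a c b" and d: "walk_value ?K a d b" for a b c d
    by (rule split[OF c]; rule split[OF d]) (auto dest: unique mixed)
  moreover have "(\<exists>d. walk_value ?K a d a') \<or> (\<exists>d. walk_value ?K a' d a)"
    if c: "walk_value ?K a c b" and d: "walk_value ?K a' d b" for a a' b c d
  proof -
    let ?f = "\<lambda>w. if w = v then u else w"
    have fixed: "?f a = a" "?f a' = a'"
      using walk_value_closed(2)[OF K c] walk_value_closed(2)[OF K d]
      by (auto simp: identify_simps split: if_splits)
    have emb: "\<exists>d. walk_value ?K (?f w) d (?f w')" if "walk_value G w d w'" for w w' d
      using walk_value_hom[of G ?K ?f "\<lambda>e. e", OF _ that] identify_morphism[of G u v]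
      by (auto simp: morphism_iff)
    have comparable: "(\<exists>d. walk_value ?K a d a') \<or> (\<exists>d. walk_value ?K a' d a)"
      if "walk_value G a x w" "walk_value G a' y w" for x y w
      using coherentD(2)[OF coh that] emb[of a _ a'] emb[of a' _ a] unfolding fixed by blast
    have jump: "(\<exists>d. walk_value ?K r d s) \<or> (\<exists>d. walk_value ?K s d r)"
      if rs: "?f r = r" "?f s = s" and rb: "walk_value G r x b" and sv: "walk_value G s y v"
        and ub: "walk_value G u z b" for r s x y z
      using coherentD(2)[OF coh rb ub]
    proof (elim disjE exE)
      fix d assume "walk_value G r d u"
      then have "walk_value G r (d \<otimes>\<^bsub>C\<^esub> \<one>\<^bsub>C\<^esub>) v" using trans uv by blast
      from coherentD(2)[OF coh this sv] show ?thesis using emb[of r _ s] emb[of s _ r] unfolding rs by blast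
    next
      fix d assume ur: "walk_value G u d r"
      obtain d1 where "walk_value ?K (?f s) d1 (?f v)" using emb[OF sv] by blast
      moreover obtain d2 where "walk_value ?K (?f u) d2 (?f r)" using emb[OF ur] by blast
      ultimately have "walk_value ?K s d1 u" "walk_value ?K u d2 r"
        unfolding rs by simp_all
      then have "walk_value ?K s (d1 \<otimes>\<^bsub>C\<^esub> d2) r" by (rule walk_value_trans[OF K])
      then show ?thesis by blast
    qed
    from split[OF c] show ?thesis
    proof cases
      case c: 1
      from split[OF d] show ?thesis
      proof cases
        case 1
        then show ?thesis using comparable c by blast
      next
        case 2
        then show ?thesis using jump[OF fixed c] by blast
      qed
    next
      case c: (2 c1 c2)
      from split[OF d] show ?thesis
      proof cases
        case 1
        then show ?thesis using jump[OF fixed(2,1) 1 c(2,3)] by blast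
      next
        case 2
        then show ?thesis using comparable c by blast
      qed
    qed
  qed
  ultimately show ?thesis unfolding coherent_def by blast
qed

lemma coherent_descendant:
  assumes "descendant \<iota> C G D" "X_graph X G" "coherent G"
  shows "coherent D"
  using assms
proof (induction rule: descendant.induct)
  case (step H u p v)
  have "walk_value H u \<one>\<^bsub>C\<^esub> v" unfolding walk_value_one_iff using step.hyps(2) by blast
  with coherent_identify[OF descendant_X_graph[OF step.hyps(1) step.prems(1)] step.IH[OF step.prems]]
  show ?case .
qed

text \<open>
  One of the sources has a walk to the other, say of value \<open>b\<close>. Then \<open>b c = c\<close> by coherence, so \<open>b = 1\<close> by
  right cancellation, and the walk is an idempath.
\<close>

lemma equal_walk_values_imp_equal_sources:
  assumes G: "X_graph X G" "coherent G" "idempath_identified \<iota> C G"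
    and u: "walk_value G u c v" and u': "walk_value G u' c v"
  shows "u = u'"
proof -
  have *: "r = s" if r: "walk_value G r c v" "walk_value G s c v" and rs: "walk_value G r b s" for r s b
  proof -
    note cl = walk_value_closed(1)[OF G(1) r(1)] walk_value_closed(1)[OF G(1) rs]
    have "b \<otimes>\<^bsub>C\<^esub> c = \<one>\<^bsub>C\<^esub> \<otimes>\<^bsub>C\<^esub> c"
      using coherentD(1)[OF G(2) walk_value_trans[OF G(1) rs r(2)] r(1)] cl by simp
    then have "b = \<one>\<^bsub>C\<^esub>" using right_cancel cl by blast
    then obtain p where "idempath \<iota> C G r p s" using rs walk_value_one_iff[of G r s] by auto
    then show ?thesis using G(3) unfolding idempath_identified_def by simp
  qed
  from coherentD(2)[OF G(2) u u'] show ?thesis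
  proof (elim disjE exE)
    show "u = u'" if "walk_value G u b u'" for b using *[OF u u' that] .
    show "u = u'" if "walk_value G u' b u" for b using *[OF u' u that] by simp
  qed
qed

end

section \<open>Splitting a tree at an arc leaving its root\<close>

text \<open>
  The part of a tree behind an arc \<open>e\<close> that leaves the root, and the part that remains when this part and
  \<open>e\<close> are removed. The end vertex stays where it is in the part that contains it; the other part ends
  at its start vertex.
\<close>

definition branch_verts :: "('v, 'e, 'x) xgraph \<Rightarrow> 'e \<Rightarrow> 'v set" where
  "branch_verts G e = {v. \<exists>p. walk G (xhead G e) p v}"

definition branch :: "('v, 'e, 'x) xgraph \<Rightarrow> 'e \<Rightarrow> ('v, 'e, 'x) xgraph" where
  "branch G e = G\<lparr> dgraph := (dgraph G)\<lparr> verts := branch_verts G e,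
       arcs := {a \<in> xarcs G. xtail G a \<in> branch_verts G e} \<rparr>,
     start_vertex := xhead G e,
     end_vertex := if end_vertex G \<in> branch_verts G e then end_vertex G else xhead G e \<rparr>"

definition remainder :: "('v, 'e, 'x) xgraph \<Rightarrow> 'e \<Rightarrow> ('v, 'e, 'x) xgraph" where
  "remainder G e = G\<lparr> dgraph := (dgraph G)\<lparr> verts := xverts G - branch_verts G e,
       arcs := {a \<in> xarcs G. xhead G a \<notin> branch_verts G e} \<rparr>,
     end_vertex := if end_vertex G \<in> branch_verts G e then start_vertex G else end_vertex G \<rparr>"

locale root_arc =
  fixes X :: "'x set" and G :: "('v, 'e, 'x) xgraph" and e
  assumes G: "arborescence X G" and e: "e \<in> xarcs G" "xtail G e = start_vertex G"
begin

abbreviation "S \<equiv> branch_verts G e"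

lemma X: "X_graph X G"
  and root: "a \<in> xarcs G \<Longrightarrow> xhead G a \<noteq> start_vertex G"
  and inj: "a \<in> xarcs G \<Longrightarrow> b \<in> xarcs G \<Longrightarrow> xhead G a = xhead G b \<Longrightarrow> a = b"
  using G by (auto simp: arborescence_def dest: inj_onD)

sublocale wf_digraph "dgraph G" by (rule X_graphD(1)[OF X])

lemma head_in_S: "xhead G e \<in> S"
  unfolding branch_verts_def using X_graphD(9)[OF X e(1)] awalk_Nil_iff by blast

lemma S_subset: "v \<in> S \<Longrightarrow> v \<in> xverts G"
  using awalk_last_in_verts by (auto simp: branch_verts_def)

lemma S_forward: 
  assumes "a \<in> xarcs G" "xtail G a \<in> S" shows "xhead G a \<in> S"
  using assms awalk_appendI[OF _ arc_implies_awalk] unfolding branch_verts_def by blast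

text \<open>
  The arc \<open>e\<close> is the only connection between the two parts.
\<close>

lemma S_backward:
  assumes a: "a \<in> xarcs G" "xhead G a \<in> S" shows "a = e \<or> xtail G a \<in> S"
proof -
  obtain p where p: "walk G (xhead G e) p (xhead G a)" using a(2) by (auto simp: branch_verts_def)
  show ?thesis
  proof (cases p rule: rev_cases)
    case Nil
    then show ?thesis using p inj[OF a(1) e(1)] by (simp add: awalk_Nil_iff)
  next
    case (snoc q b)
    note b = walk_snocD[OF wf_digraph p[unfolded snoc]]
    then have "b = a" using inj a(1) by blast
    then show ?thesis using b(1) by (auto simp: branch_verts_def)
  qed
qed

lemma start_notin_S: "start_vertex G \<notin> S"
proof
  assume "start_vertex G \<in> S"
  then obtain p where p: "walk G (xhead G e) p (start_vertex G)" by (auto simp: branch_verts_def)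
  show False
  proof (cases p rule: rev_cases)
    case Nil
    then show ?thesis using p root[OF e(1)] by (simp add: awalk_Nil_iff)
  next
    case (snoc q b)
    then show ?thesis using walk_snocD[OF wf_digraph p[unfolded snoc]] root by blast
  qed
qed

lemma branch_simps:
  "xverts (branch G e) = S" "xarcs (branch G e) = {a \<in> xarcs G. xtail G a \<in> S}"
  "xtail (branch G e) = xtail G" "xhead (branch G e) = xhead G" "label (branch G e) = label G"
  "start_vertex (branch G e) = xhead G e"
  "end_vertex (branch G e) = (if end_vertex G \<in> S then end_vertex G else xhead G e)"
  by (simp_all add: branch_def)

lemma remainder_simps:
  "xverts (remainder G e) = xverts G - S" "xarcs (remainder G e) = {a \<in> xarcs G. xhead G a \<notin> S}"
  "xtail (remainder G e) = xtail G" "xhead (remainder G e) = xhead G"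
  "label (remainder G e) = label G" "start_vertex (remainder G e) = start_vertex G"
  "end_vertex (remainder G e) = (if end_vertex G \<in> S then start_vertex G else end_vertex G)"
  by (simp_all add: remainder_def)

lemma arborescence_branch: "arborescence X (branch G e)"
proof -
  have wf: "wf_digraph (dgraph (branch G e))"
    by standard (auto simp: branch_simps S_forward)
  have "walk (branch G e) u p v" if "walk G u p v" "u \<in> S" for u p v
    using that
  proof (induction p arbitrary: u)
    case Nil
    then show ?case by (simp add: awalk_Nil_iff wf_digraph.awalk_Nil_iff[OF wf] branch_simps)
  next
    case (Cons a p)
    then show ?case
      using S_forward by (simp add: awalk_Cons_iff wf_digraph.awalk_Cons_iff[OF wf] branch_simps)
  qed
  then have "\<exists>p. walk (branch G e) (xhead G e) p v" if "v \<in> S" for v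
    using that head_in_S unfolding branch_verts_def by blast
  moreover have "finite S" using S_subset X_graphD(2)[OF X] by (meson finite_subset subsetI)
  ultimately have "X_graph X (branch G e)"
    unfolding X_graph_iff using wf head_in_S X_graphD(3,4)[OF X] by (auto simp: branch_simps)
  moreover have "xhead G a \<noteq> xhead G e" if "a \<in> xarcs G" "xtail G a \<in> S" for a
    using that inj[OF that(1) e(1)] start_notin_S e(2) by auto
  ultimately show ?thesis
    unfolding arborescence_def by (auto simp: branch_simps inj_on_def dest: inj)
qed

lemma arborescence_remainder: "arborescence X (remainder G e)"
proof -
  have wf: "wf_digraph (dgraph (remainder G e))"
    by standard (use S_forward in \<open>auto simp: remainder_simps\<close>)
  have "walk (remainder G e) u p v" if "walk G u p v" "v \<notin> S" for u p v
    using that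
  proof (induction p arbitrary: u)
    case Nil
    then show ?case by (auto simp: awalk_Nil_iff wf_digraph.awalk_Nil_iff[OF wf] remainder_simps)
  next
    case (Cons a p)
    then have a: "a \<in> xarcs G" "u = xtail G a" "walk (remainder G e) (xhead G a) p v"
      by (simp_all add: awalk_Cons_iff)
    then have "xhead G a \<notin> S"
      using wf_digraph.awalk_hd_in_verts[OF wf a(3)] by (simp add: remainder_simps)
    then show ?case using a by (simp add: wf_digraph.awalk_Cons_iff[OF wf] remainder_simps)
  qed
  then have "\<exists>p. walk (remainder G e) (start_vertex G) p v" if "v \<in> xverts G" "v \<notin> S" for v
    using that X_graphD(7)[OF X] by blast
  then have "X_graph X (remainder G e)"
    unfolding X_graph_iff using wf start_notin_S X_graphD(2-6)[OF X] by (auto simp: remainder_simps)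
  then show ?thesis
    unfolding arborescence_def by (auto simp: remainder_simps inj_on_def root dest: inj)
qed

lemma card_arcs_less:
  "card (xarcs (branch G e)) < card (xarcs G)" "card (xarcs (remainder G e)) < card (xarcs G)"
proof -
  have "e \<notin> xarcs (branch G e)" "e \<notin> xarcs (remainder G e)"
    using e start_notin_S head_in_S by (auto simp: branch_simps remainder_simps)
  then have "xarcs (branch G e) \<subset> xarcs G" "xarcs (remainder G e) \<subset> xarcs G"
    using e(1) by (auto simp: branch_simps remainder_simps)
  then show "card (xarcs (branch G e)) < card (xarcs G)" "card (xarcs (remainder G e)) < card (xarcs G)"
    using psubset_card_mono[OF X_graphD(3)[OF X]] by blast+
qed

lemma hom_restrict:
  assumes "graph_hom G K f g"
  shows "graph_hom (branch G e) K f g" "graph_hom (remainder G e) K f g"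
    "graph_hom (edge_tree (label G e)) K
       (\<lambda>n. if n = 0 then f (start_vertex G) else f (xhead G e)) (\<lambda>_. g e)"
  using assms S_subset e X_graphD(5)[OF X] X_graphD(9)[OF X e(1)]
  by (auto simp: graph_hom_def branch_simps remainder_simps edge_tree_def Pi_iff)

lemma hom_union:
  assumes r: "graph_hom (remainder G e) K f g" and b: "graph_hom (branch G e) K f' g'"
    and h: "graph_hom (edge_tree (label G e)) K h k"
    and ends: "h 0 = f (start_vertex G)" "h 1 = f' (xhead G e)"
  shows "graph_hom G K (\<lambda>v. if v \<in> S then f' v else f v)
    (\<lambda>a. if a = e then k 0 else if xtail G a \<in> S then g' a else g a)"
    (is "graph_hom G K ?f ?g")
proof -
  have "?g a \<in> xarcs K \<and> label K (?g a) = label G a \<and>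
      xtail K (?g a) = ?f (xtail G a) \<and> xhead K (?g a) = ?f (xhead G a)" if a: "a \<in> xarcs G" for a
  proof -
    consider "a = e" | "a \<noteq> e" "xtail G a \<in> S" "xhead G a \<in> S" | "a \<noteq> e" "xtail G a \<notin> S" "xhead G a \<notin> S"
      using S_forward S_backward a by blast
    then show ?thesis
    proof cases
      case 1
      then show ?thesis
        using h ends e head_in_S start_notin_S by (auto simp: graph_hom_def edge_tree_def)
    next
      case 2
      then show ?thesis using b a by (auto simp: graph_hom_def branch_simps)
    next
      case 3
      then show ?thesis using r a by (auto simp: graph_hom_def remainder_simps)
    qed
  qed
  moreover have "?f v \<in> xverts K" if "v \<in> xverts G" for v
    using that r b by (auto simp: graph_hom_def branch_simps remainder_simps Pi_iff)
  ultimately show ?thesis by (simp add: graph_hom_def Pi_iff)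
qed

lemma end_pairs_edge:
  "end_pairs (edge_tree x) K = {(h 0, h 1) | h k. graph_hom (edge_tree x) K h k}"
  by (simp add: end_pairs_def edge_tree_def)

text \<open>
  In terms of pretzels: if the end vertex lies in the branch, the tree is the product of the remainder, the
  arc \<open>e\<close> and the branch; otherwise it is \<open>(E B)\<^sup>+ A\<close> for the arc \<open>E\<close>, the branch \<open>B\<close> and the
  remainder \<open>A\<close>.
\<close>

lemma end_pairs_split_end_in_branch:
  assumes "end_vertex G \<in> S"
  shows "end_pairs G K =
    end_pairs (remainder G e) K O end_pairs (edge_tree (label G e)) K O end_pairs (branch G e) K"
proof (intro equalityI subsetI)
  fix p assume "p \<in> end_pairs G K"
  then obtain f g where f: "graph_hom G K f g" "p = (f (start_vertex G), f (end_vertex G))"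
    by (auto simp: end_pairs_def)
  note h = hom_restrict[OF f(1)]
  have "(f (start_vertex G), f (start_vertex G)) \<in> end_pairs (remainder G e) K"
    using h(2) by (rule end_pairsI) (simp_all add: remainder_simps assms)
  moreover have "(f (start_vertex G), f (xhead G e)) \<in> end_pairs (edge_tree (label G e)) K"
    using h(3) by (rule end_pairsI) (simp_all add: edge_tree_def)
  moreover have "(f (xhead G e), f (end_vertex G)) \<in> end_pairs (branch G e) K"
    using h(1) by (rule end_pairsI) (simp_all add: branch_simps assms)
  ultimately show "p \<in> end_pairs (remainder G e) K O end_pairs (edge_tree (label G e)) K O end_pairs (branch G e) K"
    using f(2) by blast
next
  fix p assume "p \<in> end_pairs (remainder G e) K O end_pairs (edge_tree (label G e)) K O end_pairs (branch G e) K"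
  then obtain s u v t where p: "p = (s, t)" "(s, u) \<in> end_pairs (remainder G e) K"
    "(u, v) \<in> end_pairs (edge_tree (label G e)) K" "(v, t) \<in> end_pairs (branch G e) K" by blast
  obtain f g where f: "graph_hom (remainder G e) K f g" "s = f (start_vertex G)" "u = f (start_vertex G)"
    using p(2) assms by (auto simp: end_pairs_def remainder_simps)
  obtain f' g' where f': "graph_hom (branch G e) K f' g'" "v = f' (xhead G e)" "t = f' (end_vertex G)"
    using p(4) assms by (auto simp: end_pairs_def branch_simps)
  obtain h k where h: "graph_hom (edge_tree (label G e)) K h k" "u = h 0" "v = h 1"
    using p(3) unfolding end_pairs_edge by auto
  have "graph_hom G K (\<lambda>v. if v \<in> S then f' v else f v)
    (\<lambda>a. if a = e then k 0 else if xtail G a \<in> S then g' a else g a)"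
    using hom_union[OF f(1) f'(1) h(1)] f f' h by simp
  then show "p \<in> end_pairs G K"
    unfolding p(1) by (rule end_pairsI) (simp_all add: assms start_notin_S f f')
qed

lemma end_pairs_split_end_in_remainder:
  assumes "end_vertex G \<notin> S"
  shows "end_pairs G K =
    Id_on (Domain (end_pairs (edge_tree (label G e)) K O end_pairs (branch G e) K))
      O end_pairs (remainder G e) K"
proof (intro equalityI subsetI)
  fix p assume "p \<in> end_pairs G K"
  then obtain f g where f: "graph_hom G K f g" "p = (f (start_vertex G), f (end_vertex G))"
    by (auto simp: end_pairs_def)
  note h = hom_restrict[OF f(1)]
  have "(f (start_vertex G), f (end_vertex G)) \<in> end_pairs (remainder G e) K"
    using h(2) by (rule end_pairsI) (simp_all add: remainder_simps assms)
  moreover have "(f (start_vertex G), f (xhead G e)) \<in> end_pairs (edge_tree (label G e)) K"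
    using h(3) by (rule end_pairsI) (simp_all add: edge_tree_def)
  moreover have "(f (xhead G e), f (xhead G e)) \<in> end_pairs (branch G e) K"
    using h(1) by (rule end_pairsI) (simp_all add: branch_simps assms)
  ultimately show "p \<in> Id_on (Domain (end_pairs (edge_tree (label G e)) K O end_pairs (branch G e) K))
      O end_pairs (remainder G e) K"
    using f(2) by blast
next
  fix p assume "p \<in> Id_on (Domain (end_pairs (edge_tree (label G e)) K O end_pairs (branch G e) K))
      O end_pairs (remainder G e) K"
  then obtain s v w t where p: "p = (s, t)" "(s, v) \<in> end_pairs (edge_tree (label G e)) K"
    "(v, w) \<in> end_pairs (branch G e) K" "(s, t) \<in> end_pairs (remainder G e) K" by blast
  obtain f g where f: "graph_hom (remainder G e) K f g" "s = f (start_vertex G)" "t = f (end_vertex G)"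
    using p(4) assms by (auto simp: end_pairs_def remainder_simps)
  obtain f' g' where f': "graph_hom (branch G e) K f' g'" "v = f' (xhead G e)"
    using p(3) assms by (auto simp: end_pairs_def branch_simps)
  obtain h k where h: "graph_hom (edge_tree (label G e)) K h k" "s = h 0" "v = h 1"
    using p(2) unfolding end_pairs_edge by auto
  have "graph_hom G K (\<lambda>v. if v \<in> S then f' v else f v)
    (\<lambda>a. if a = e then k 0 else if xtail G a \<in> S then g' a else g a)"
    using hom_union[OF f(1) f'(1) h(1)] f f' h by simp
  then show "p \<in> end_pairs G K"
    unfolding p(1) by (rule end_pairsI) (simp_all add: assms start_notin_S f)
qed

end

lemma root_arc_exists:
  assumes G: "arborescence X G" and "xarcs G \<noteq> {}"
  obtains e where "root_arc X G e"
proof -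
  have X: "X_graph X G" using G by (simp add: arborescence_def)
  note wf = X_graphD(1)[OF X]
  obtain a where a: "a \<in> xarcs G" using assms(2) by blast
  obtain p where p: "walk G (start_vertex G) p (xtail G a)"
    using X_graphD(7)[OF X X_graphD(8)[OF X a]] by blast
  have "\<exists>e\<in>xarcs G. xtail G e = start_vertex G"
    using p a by (cases p) (auto simp: wf_digraph.awalk_simps[OF wf])
  then show ?thesis using that G by (auto simp: root_arc_def)
qed

section \<open>The algebra of pretzels\<close>

context pretzels
begin

lemma arborescence_X_graph: "arborescence X G \<Longrightarrow> X_graph X G"
  by (simp add: arborescence_def)

lemma coherent_reflection_exists:
  assumes "arborescence X G"
  obtains D q where "X_graph X D" "coherent D" "idempath_identified \<iota> C D"
    "reflects \<iota> C G D q" "G \<simeq> D"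
proof -
  note G = arborescence_X_graph[OF assms]
  obtain D where D: "descendant \<iota> C G D" "idempath_identified \<iota> C D"
    using identified_descendant_exists[OF G] .
  obtain q where "reflects \<iota> C G D q" using descendant_reflects[OF D(1) G] by blast
  then show ?thesis
    using that D descendant_X_graph[OF D(1) G] coherent_descendant[OF D(1) G]
      coherent_arborescence[OF assms] similar_descendant[OF D(1) G] by blast
qed

lemma trunk_value:
  assumes "X_graph X G"
  obtains c where "walk_value G (start_vertex G) c (end_vertex G)"
proof -
  obtain p where "walk G (start_vertex G) p (end_vertex G)"
    using X_graphD(7)[OF assms X_graphD(6)[OF assms]] by blast
  from that[OF walk_valueI[OF this]] show ?thesis .
qed

text \<open>
  The values \<open>c c\<close> and \<open>c\<close> of the walks from start to end in \<open>T \<times> T\<close> and in \<open>T\<close> agree, since both walks are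
  mapped to walks between the base points of the coherent graph \<open>D\<close>. So \<open>c = 1\<close>, and homomorphisms
  into identified graphs send both base points of \<open>T\<close> to the same vertex.
\<close>

lemma idempotent_similar_plus:
  assumes T: "arborescence X T" and idem: "graph_times T T \<simeq> T"
  shows "T \<simeq> graph_plus T"
proof -
  note TX = arborescence_X_graph[OF T]
  obtain D q where D: "X_graph X D" "coherent D" "idempath_identified \<iota> C D"
    "reflects \<iota> C T D q" "T \<simeq> D" using coherent_reflection_exists[OF T] .
  note q = reflectsD(1)[OF D(4), unfolded morphism_iff]
  obtain f g where "morphism (graph_times T T) D f g"
    using similar_imp_morphism[OF similar_trans[OF idem D(5)] D(1,3)] .
  note f = this[unfolded morphism_iff]
  obtain c where c: "walk_value T (start_vertex T) c (end_vertex T)" using trunk_value[OF TX] .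
  have cc: "c \<in> carrier C" using walk_value_closed(1)[OF TX c] .
  note XT = X_graph_times[OF TX TX]
  have 1: "walk_value (graph_times T T) (Inl (start_vertex T)) c (Inl (end_vertex T))"
    using walk_value_hom[OF graph_times_homs(1)[OF TX TX] c] .
  have 2: "walk_value (graph_times T T) (Inl (end_vertex T)) c (glue T T (end_vertex T))"
    using walk_value_hom[OF graph_times_homs(2)[OF TX TX] c] by (simp add: glue_def)
  have "walk_value D (start_vertex D) (c \<otimes>\<^bsub>C\<^esub> c) (end_vertex D)"
    using walk_value_hom[OF conjunct1[OF f] walk_value_trans[OF XT 1 2]] f
    by (simp add: graph_times_simps)
  moreover have "walk_value D (start_vertex D) c (end_vertex D)"
    using walk_value_hom[OF conjunct1[OF q] c] q by simp
  ultimately have "c \<otimes>\<^bsub>C\<^esub> c = \<one>\<^bsub>C\<^esub> \<otimes>\<^bsub>C\<^esub> c" using coherentD(1)[OF D(2)] cc by simp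
  then have "c = \<one>\<^bsub>C\<^esub>" using right_cancel cc by blast
  then obtain p where p: "idempath \<iota> C T (start_vertex T) p (end_vertex T)"
    using c walk_value_one_iff[of T] by auto
  show ?thesis
    unfolding similar_def
  proof (intro allI impI)
    fix K :: "(nat, nat, 'x) xgraph" assume K: "idempath_identified \<iota> C K"
    have "end_pairs T K \<subseteq> Id" using idempath_hom[OF _ K p] by (auto simp: end_pairs_def)
    then show "end_pairs T K = end_pairs (graph_plus T) K" unfolding end_pairs_plus by blast
  qed
qed

lemma graph_times_plus:
  "graph_times G (graph_plus H) = (graph_times G H)\<lparr> end_vertex := Inl (end_vertex G) \<rparr>"
  by (simp add: graph_times_def identify_def Let_def graph_plus_def)

lemma end_pairs_times_plus:
  "end_pairs (graph_times G (graph_plus H)) K =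
     {(f (Inl (start_vertex G)), f (Inl (end_vertex G))) | f g. graph_hom (graph_times G H) K f g}"
  unfolding graph_times_plus by (simp add: end_pairs_def graph_hom_def graph_times_simps)

text \<open>
  The core of the proof of left adequacy: cancelling the walk through \<open>T\<close> from its end shows that the
  morphism from \<open>G \<times> T\<close> to the reflection \<open>D\<close> of \<open>G' \<times> T\<close> matches the ends of \<open>G\<close> and \<open>G'\<close>. Composition
  with it turns homomorphisms from \<open>G' \<times> T\<close> into homomorphisms from \<open>G \<times> T\<close> with the same values at the base
  points of the first factors.
\<close>

lemma cancel_into_plus:
  fixes G :: "('v, 'e, 'x) xgraph" and G' :: "('w, 'f, 'x) xgraph" and T :: "('u, 'd, 'x) xgraph"
    and K :: "(nat, nat, 'x) xgraph"
  assumes G: "arborescence X G" and G': "arborescence X G'" and T: "arborescence X T"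
    and sim: "graph_times G T \<simeq> graph_times G' T" and K: "idempath_identified \<iota> C K"
  shows "end_pairs (graph_times G' (graph_plus T)) K \<subseteq> end_pairs (graph_times G (graph_plus T)) K"
proof
  note GX = arborescence_X_graph[OF G] and GX' = arborescence_X_graph[OF G']
    and TX = arborescence_X_graph[OF T]
  obtain D q where D: "X_graph X D" "coherent D" "idempath_identified \<iota> C D"
    "reflects \<iota> C (graph_times G' T) D q" "graph_times G' T \<simeq> D"
    using coherent_reflection_exists[OF arborescence_times[OF G' T]] .
  note q = reflectsD(1)[OF D(4), unfolded morphism_iff]
  obtain f g where "morphism (graph_times G T) D f g"
    using similar_imp_morphism[OF similar_trans[OF sim D(5)] D(1,3)] .
  note f = this[unfolded morphism_iff]
  obtain c where c: "walk_value T (start_vertex T) c (end_vertex T)" using trunk_value[OF TX] .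
  have 1: "walk_value (graph_times G T) (Inl (end_vertex G)) c (end_vertex (graph_times G T))"
    using walk_value_hom[OF graph_times_homs(2)[OF GX TX] c] by (simp add: glue_def graph_times_simps)
  have 2: "walk_value (graph_times G' T) (Inl (end_vertex G')) c (end_vertex (graph_times G' T))"
    using walk_value_hom[OF graph_times_homs(2)[OF GX' TX] c] by (simp add: glue_def graph_times_simps)
  have mid: "f (Inl (end_vertex G)) = q (Inl (end_vertex G'))"
  proof (rule equal_walk_values_imp_equal_sources[OF D(1-3)])
    show "walk_value D (f (Inl (end_vertex G))) c (end_vertex D)"
      using walk_value_hom[OF conjunct1[OF f] 1] f by simp
    show "walk_value D (q (Inl (end_vertex G'))) c (end_vertex D)"
      using walk_value_hom[OF conjunct1[OF q] 2] q by simp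
  qed
  fix p assume "p \<in> end_pairs (graph_times G' (graph_plus T)) K"
  then obtain f' g' where f': "graph_hom (graph_times G' T) K f' g'"
    "p = (f' (Inl (start_vertex G')), f' (Inl (end_vertex G')))"
    by (auto simp: end_pairs_times_plus)
  have in_verts: "Inl (start_vertex G') \<in> xverts (graph_times G' T)"
    "Inl (end_vertex G') \<in> xverts (graph_times G' T)"
    using graph_times_homs(1)[OF GX' TX] X_graphD(5,6)[OF GX'] by (auto simp: graph_hom_def)
  have "graph_hom (graph_times G T) K (f' \<circ> f) (g' \<circ> g)"
    using graph_hom_comp[OF conjunct1[OF f] reflectsD(2)[OF D(4) K f'(1)]] .
  moreover have "f' (f (Inl (start_vertex G))) = f' (Inl (start_vertex G'))"
    using f q reflectsD(3)[OF D(4) K f'(1) in_verts(1)] by (simp add: graph_times_simps)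
  moreover have "f' (f (Inl (end_vertex G))) = f' (Inl (end_vertex G'))"
    using mid reflectsD(3)[OF D(4) K f'(1) in_verts(2)] by simp
  ultimately show "p \<in> end_pairs (graph_times G (graph_plus T)) K"
    unfolding end_pairs_times_plus f'(2) by (metis (mono_tags, lifting) comp_apply mem_Collect_eq)
qed

abbreviation "P \<equiv> PT X \<iota> C"
abbreviation "pz \<equiv> pretzel X \<iota> C"

text \<open>
  The carrier is defined by retracted trees on the natural numbers; the core of a copy is one
  with the same pretzel.
\<close>

lemma pretzel_in_carrier:
  fixes G :: "('v, 'e, 'x) xgraph"
  assumes "arborescence X G"
  shows "pz G \<in> carrier P"
proof -
  note GX = arborescence_X_graph[OF assms]
  obtain H :: "(nat, nat, 'x) xgraph" where H: "X_graph X H" "isomorphic H G"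
    using isomorphic_nat_copy[OF GX] .
  obtain T where T: "core_of H T" using core_exists[OF H(1)] .
  obtain f g where TX: "X_graph X T" "retracted T" "morphism T H (\<lambda>v. v) (\<lambda>e. e)"
    by (rule core_ofD[OF H(1) T])
  obtain f' g' where f': "morphism H G f' g'" "inj_on g' (xarcs H)"
    using H(2) by (auto simp: isomorphic_def bij_betw_def)
  have "arborescence X H" using arborescence_if_embeds[OF assms H(1) f'] .
  then have "arborescence X T" using arborescence_if_embeds[OF _ TX(1,3)] by (simp add: inj_on_def)
  then have "iso_type X T \<in> FLAd X"
    using TX(2) arborescence_imp_X_tree unfolding FLAd_def by blast
  moreover have "T \<in> iso_type X T"
  proof -
    have "isomorphic T T" unfolding isomorphic_def
      by (rule exI[of _ "\<lambda>v. v"], rule exI[of _ "\<lambda>e. e"]) (auto simp: morphism_def bij_betw_def inj_on_def)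
    then show ?thesis using TX(1) by (simp add: iso_type_def)
  qed
  moreover have "G \<simeq> T"
    using similar_if_isomorphic[OF H(2,1)] similar_core[OF H(1) T] similar_sym similar_trans by metis
  then have "pz G = pz T" using pretzel_eq_iff[OF GX TX(1)] by blast
  ultimately show ?thesis by (auto simp: PT_def)
qed

lemma in_carrierE:
  assumes "a \<in> carrier P"
  obtains T :: "(nat, nat, 'x) xgraph" where "arborescence X T" "a = pz T"
proof -
  obtain T G :: "(nat, nat, 'x) xgraph" where T: "X_tree X T" "X_graph X G" "isomorphic G T" "a = pz G"
    using assms by (auto simp: PT_def FLAd_def iso_type_def)
  obtain f g where f: "morphism G T f g" "inj_on g (xarcs G)"
    using T(3) by (auto simp: isomorphic_def bij_betw_def)
  have "arborescence X G"
    using arborescence_if_embeds[OF X_tree_imp_arborescence[OF T(1)] T(2) f] .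
  then show ?thesis using that T(4) by blast
qed

lemma mult_arborescences:
  "arborescence X G \<Longrightarrow> arborescence X H \<Longrightarrow> pz G \<otimes>\<^bsub>P\<^esub> pz H = pz (graph_times G H)"
  by (simp add: mult_pretzels arborescence_X_graph)

lemma uplus_arborescence: "arborescence X G \<Longrightarrow> uplus P (pz G) = pz (graph_plus G)"
  by (simp add: uplus_pretzel arborescence_X_graph)

lemma pretzel_eqI:
  assumes "arborescence X G" "arborescence X H"
    and "\<And>K :: (nat, nat, 'x) xgraph. idempath_identified \<iota> C K \<Longrightarrow> end_pairs G K = end_pairs H K"
  shows "pz G = pz H"
  using assms(3) pretzel_eq_iff[OF assms(1,2)[THEN arborescence_X_graph]]
  unfolding similar_def by simp

lemmas arborescences = arborescence_times arborescence_plus arborescence_trivial arborescence_edge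

lemmas end_pairs_simps = end_pairs_times[OF arborescence_X_graph arborescence_X_graph]
  end_pairs_plus end_pairs_trivial

lemma end_pairs_subset_verts:
  "X_graph X G \<Longrightarrow> end_pairs G K \<subseteq> xverts K \<times> xverts K"
  using X_graphD(5,6) by (fastforce simp: end_pairs_def graph_hom_def)

lemma monoid_P: "monoid P"
proof
  fix a b assume "a \<in> carrier P" "b \<in> carrier P"
  then show "a \<otimes>\<^bsub>P\<^esub> b \<in> carrier P"
    by (elim in_carrierE) (simp add: mult_arborescences pretzel_in_carrier arborescences)
next
  fix a b c assume "a \<in> carrier P" "b \<in> carrier P" "c \<in> carrier P"
  then obtain S T U :: "(nat, nat, 'x) xgraph" where
    T: "arborescence X S" "arborescence X T" "arborescence X U" "a = pz S" "b = pz T" "c = pz U"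
    using in_carrierE by metis
  have "pz (graph_times (graph_times S T) U) = pz (graph_times S (graph_times T U))"
    using T by (intro pretzel_eqI) (simp_all add: arborescences end_pairs_simps O_assoc)
  then show "a \<otimes>\<^bsub>P\<^esub> b \<otimes>\<^bsub>P\<^esub> c = a \<otimes>\<^bsub>P\<^esub> (b \<otimes>\<^bsub>P\<^esub> c)"
    using T by (simp add: mult_arborescences arborescences)
next
  show "\<one>\<^bsub>P\<^esub> \<in> carrier P" by (simp add: one_pretzel pretzel_in_carrier arborescences)
next
  fix a assume "a \<in> carrier P"
  then obtain T :: "(nat, nat, 'x) xgraph" where T: "arborescence X T" "a = pz T"
    by (rule in_carrierE)
  have "end_pairs (graph_times trivial_graph T) K = end_pairs T K"
    "end_pairs (graph_times T trivial_graph) K = end_pairs T K" for K :: "(nat, nat, 'x) xgraph"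
    using end_pairs_subset_verts[OF arborescence_X_graph[OF T(1)], of K] T(1)
    by (auto simp: end_pairs_simps arborescences)
  then have "pz (graph_times trivial_graph T) = pz T" "pz (graph_times T trivial_graph) = pz T"
    using T(1) by - ((intro pretzel_eqI; simp add: arborescences)+)
  then show "\<one>\<^bsub>P\<^esub> \<otimes>\<^bsub>P\<^esub> a = a" "a \<otimes>\<^bsub>P\<^esub> \<one>\<^bsub>P\<^esub> = a"
    using T by (simp_all add: one_pretzel mult_arborescences arborescences)
qed

lemma uplus_idempotent:
  assumes "a \<in> carrier P"
  shows "uplus P a \<in> idempotents P"
proof -
  obtain T :: "(nat, nat, 'x) xgraph" where T: "arborescence X T" "a = pz T"
    using in_carrierE[OF assms] .
  have "pz (graph_times (graph_plus T) (graph_plus T)) = pz (graph_plus T)"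
    using T(1) by (intro pretzel_eqI) (auto simp: arborescences end_pairs_simps)
  then show ?thesis
    using T by (simp add: idempotents_def uplus_arborescence mult_arborescences arborescences pretzel_in_carrier)
qed

lemma idempotent_eq_uplus:
  assumes "a \<in> idempotents P"
  shows "uplus P a = a"
proof -
  have a: "a \<in> carrier P" "a \<otimes>\<^bsub>P\<^esub> a = a" using assms by (auto simp: idempotents_def)
  obtain T :: "(nat, nat, 'x) xgraph" where T: "arborescence X T" "a = pz T"
    using in_carrierE[OF a(1)] .
  note TX = arborescence_X_graph[OF T(1)]
  have "graph_times T T \<simeq> T"
    using a(2) pretzel_eq_iff[OF X_graph_times[OF TX TX] TX] T by (simp add: mult_arborescences)
  from idempotent_similar_plus[OF T(1) this] have "pz T = pz (graph_plus T)"
    using pretzel_eq_iff[OF TX X_graph_plus[OF TX]] by blast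
  then show ?thesis using uplus_arborescence[OF T(1)] T(2) by simp
qed

text \<open>
  By the previous lemma both idempotents are represented by subidentities, which commute under
  composition.
\<close>

lemma idempotents_commute:
  assumes "a \<in> idempotents P" "b \<in> idempotents P"
  shows "a \<otimes>\<^bsub>P\<^esub> b = b \<otimes>\<^bsub>P\<^esub> a"
proof -
  have "a \<in> carrier P" "b \<in> carrier P" using assms by (auto simp: idempotents_def)
  then obtain S T :: "(nat, nat, 'x) xgraph" where
    S: "arborescence X S" "a = pz S" and T: "arborescence X T" "b = pz T"
    using in_carrierE by metis
  have "pz (graph_times (graph_plus S) (graph_plus T)) = pz (graph_times (graph_plus T) (graph_plus S))"
    using S(1) T(1) by (intro pretzel_eqI) (auto simp: arborescences end_pairs_simps)
  moreover have "a = pz (graph_plus S)" "b = pz (graph_plus T)"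
    using idempotent_eq_uplus[OF assms(1)] idempotent_eq_uplus[OF assms(2)] S T
    by (simp_all add: uplus_arborescence)
  ultimately show ?thesis using S T by (simp add: mult_arborescences arborescences)
qed

text \<open>
  Cancellation in one direction is \<open>cancel_into_plus\<close>; the converse follows from \<open>a\<^sup>+ a = a\<close>.
\<close>

lemma Rstar_uplus:
  assumes "a \<in> carrier P"
  shows "Rstar P a (uplus P a)"
  unfolding Rstar_def
proof (intro conjI ballI iffI)
  interpret P: monoid P by (rule monoid_P)
  obtain T :: "(nat, nat, 'x) xgraph" where T: "arborescence X T" "a = pz T"
    using in_carrierE[OF assms] .
  show p: "uplus P a \<in> carrier P" using uplus_idempotent[OF assms] by (simp add: idempotents_def)
  fix x y assume x: "x \<in> carrier P" and y: "y \<in> carrier P"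
  obtain G :: "(nat, nat, 'x) xgraph" where G: "arborescence X G" "x = pz G"
    using in_carrierE[OF x] .
  obtain G' :: "(nat, nat, 'x) xgraph" where G': "arborescence X G'" "y = pz G'"
    using in_carrierE[OF y] .
  show "x \<otimes>\<^bsub>P\<^esub> uplus P a = y \<otimes>\<^bsub>P\<^esub> uplus P a" if "x \<otimes>\<^bsub>P\<^esub> a = y \<otimes>\<^bsub>P\<^esub> a"
  proof -
    have "graph_times G T \<simeq> graph_times G' T"
      using that G G' T pretzel_eq_iff[of "graph_times G T" "graph_times G' T"]
      by (simp add: mult_arborescences X_graph_times arborescence_X_graph)
    then have "pz (graph_times G (graph_plus T)) = pz (graph_times G' (graph_plus T))"
      using cancel_into_plus[OF G(1) G'(1) T(1)] cancel_into_plus[OF G'(1) G(1) T(1) similar_sym]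
        G(1) G'(1) T(1)
      by (intro pretzel_eqI equalityI) (auto simp: arborescences)
    then show ?thesis using G G' T by (simp add: uplus_arborescence mult_arborescences arborescences)
  qed
  have "pz (graph_times (graph_plus T) T) = pz T"
    using T(1) by (intro pretzel_eqI) (auto simp: arborescences end_pairs_simps)
  then have pa: "uplus P a \<otimes>\<^bsub>P\<^esub> a = a"
    using T by (simp add: uplus_arborescence mult_arborescences arborescences)
  show "x \<otimes>\<^bsub>P\<^esub> a = y \<otimes>\<^bsub>P\<^esub> a" if "x \<otimes>\<^bsub>P\<^esub> uplus P a = y \<otimes>\<^bsub>P\<^esub> uplus P a"
    using that P.m_assoc[OF x p assms] P.m_assoc[OF y p assms] by (simp add: pa)
qed (rule assms)

lemma left_adequate_P: "left_adequate_monoid P"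
  unfolding left_adequate_monoid_def
  using monoid_P idempotents_commute uplus_idempotent Rstar_uplus by blast

text \<open>
  Induction on the number of arcs, splitting the tree at an arc that leaves its root.
\<close>

lemma pretzel_generated:
  fixes G :: "('v, 'e, 'x) xgraph"
  assumes H: "submonoid H P" "\<forall>a\<in>H. uplus P a \<in> H" "(\<lambda>x. pz (edge_tree x)) ` X \<subseteq> H"
    and "arborescence X G"
  shows "pz G \<in> H"
  using assms(4)
proof (induction "card (xarcs G)" arbitrary: G rule: less_induct)
  case less
  note GX = arborescence_X_graph[OF less.prems]
  note mult = submonoid.m_closed[OF H(1)]
  show ?case
  proof (cases "xarcs G = {}")
    case True
    have "xverts G = {start_vertex G}" 
    proof (intro equalityI subsetI)
      fix v assume "v \<in> xverts G"
      then obtain p where "walk G (start_vertex G) p v" using X_graphD(7)[OF GX] by blast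
      then show "v \<in> {start_vertex G}" using True
        by (cases p) (auto simp: wf_digraph.awalk_simps[OF X_graphD(1)[OF GX]])
    qed (use X_graphD(5)[OF GX] in auto)
    then have "end_pairs G K = Id_on (xverts K)" for K :: "(nat, nat, 'x) xgraph"
      using X_graphD(6)[OF GX] True
      by (auto simp: end_pairs_def graph_hom_def intro!: exI[of _ "\<lambda>_. _"])
    then have "pz G = pz trivial_graph"
      using less.prems by (intro pretzel_eqI) (simp_all add: arborescences end_pairs_trivial)
    then show ?thesis using submonoid.one_closed[OF H(1)] one_pretzel by simp
  next
    case False
    then obtain e where "root_arc X G e" using root_arc_exists[OF less.prems] by blast
    then interpret root_arc X G e .
    let ?A = "remainder G e" and ?B = "branch G e" and ?E = "edge_tree (label G e)"
    have label: "label G e \<in> X" using X_graphD(4)[OF GX e(1)] .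
    have inH: "pz ?A \<in> H" "pz ?B \<in> H" "pz ?E \<in> H"
      using less.hyps[OF card_arcs_less(2) arborescence_remainder]
        less.hyps[OF card_arcs_less(1) arborescence_branch] H(3) label by auto
    note arb = arborescences arborescence_branch arborescence_remainder arborescence_edge[OF label]
    show ?thesis
    proof (cases "end_vertex G \<in> S")
      case True
      have "pz G = pz (graph_times ?A (graph_times ?E ?B))"
        using less.prems label
        by (intro pretzel_eqI) (simp_all add: arb end_pairs_simps end_pairs_split_end_in_branch[OF True])
      also have "\<dots> = pz ?A \<otimes>\<^bsub>P\<^esub> (pz ?E \<otimes>\<^bsub>P\<^esub> pz ?B)"
        using label by (simp add: mult_arborescences arb)
      finally show ?thesis using mult inH by simp
    next
      case False
      have "pz G = pz (graph_times (graph_plus (graph_times ?E ?B)) ?A)"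
        using less.prems label
        by (intro pretzel_eqI) (simp_all add: arb end_pairs_simps end_pairs_split_end_in_remainder[OF False])
      also have "\<dots> = uplus P (pz ?E \<otimes>\<^bsub>P\<^esub> pz ?B) \<otimes>\<^bsub>P\<^esub> pz ?A"
        using label by (simp add: mult_arborescences uplus_arborescence arb)
      finally show ?thesis using mult inH H(2) by simp
    qed
  qed
qed

lemma generated_left_adequate_P:
  "generated_left_adequate_monoid X (\<lambda>x. pz (edge_tree x)) P"
  unfolding generated_left_adequate_monoid_def
proof (intro conjI allI impI)
  show "left_adequate_monoid P" by (rule left_adequate_P)
  show "(\<lambda>x. pz (edge_tree x)) \<in> X \<rightarrow> carrier P"
    by (auto intro: pretzel_in_carrier arborescence_edge)
  fix H assume H: "submonoid H P \<and> (\<forall>a\<in>H. uplus P a \<in> H) \<and> (\<lambda>x. pz (edge_tree x)) ` X \<subseteq> H"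
  have "carrier P \<subseteq> H"
  proof
    fix a assume "a \<in> carrier P"
    then obtain T :: "(nat, nat, 'x) xgraph" where "arborescence X T" "a = pz T"
      by (rule in_carrierE)
    then show "a \<in> H" using pretzel_generated H by blast
  qed
  then show "H = carrier P" using H submonoid.subset by blast
qed

end

theorem corollary4p14:
  fixes X :: "'x set" and \<iota> :: "'x \<Rightarrow> 'c" and C :: "('c, 'm) monoid_scheme"
  assumes "X \<noteq> {}"
    and "generated_monoid X \<iota> C"
    and "right_cancellative C"
  shows "generated_left_adequate_monoid X (\<lambda>x. pretzel X \<iota> C (edge_tree x)) (PT X \<iota> C)"
proof -
  interpret pretzels X \<iota> C using assms(2,3) by unfold_locales
  show ?thesis by (rule generated_left_adequate_P)
qed

end
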